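(* Every finite simple planar graph $G$ of girth at least $4$ satisfies $\operatorname{diam}(I(G))\le 7$.
   Context: All graphs are finite, simple and undirected. The girth of a graph is the length of a shortest cycle (infinite if the graph is acyclic). An orientation of $G$ assigns a direction to each edge of $G$. Given an orientation $\vec G$ of $G$ and a set $X\subseteq V(G)$, the inversion of $X$ is the operation that reverses the orientation of every arc with both endpoints in $X$. The inversion graph $I(G)$ has as its vertices the labeled orientations of $G$, two orientations being adjacent when one is obtained from the other by a single inversion. The inversion diameter $\operatorname{diam}(I(G))$ is the diameter of $I(G)$, i.e. the largest, over all pairs of orientations of $G$, of the minimum number of inversions transforming one into the other. *)

theory Defs
  imports "HOL-Analysis.Analysis" "HOL-Library.Extended_Nat"
begin

record 'a ugraph =
  verts :: "'a set"
  edges :: "'a set set"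

definition simple_graph :: "'a ugraph \<Rightarrow> bool" where
  "simple_graph G \<longleftrightarrow> finite (verts G) \<and> (\<forall>e\<in>edges G. e \<subseteq> verts G \<and> card e = 2)"

definition walk :: "'a ugraph \<Rightarrow> 'a list \<Rightarrow> bool" where
  "walk G xs \<longleftrightarrow> xs \<noteq> [] \<and> set xs \<subseteq> verts G \<and> successively (\<lambda>u v. {u, v} \<in> edges G) xs"

text \<open>A cycle is given by the list of its vertices, the first one not being repeated at the end;
  so its length is the length of the list.\<close>

definition graph_cycle :: "'a ugraph \<Rightarrow> 'a list \<Rightarrow> bool" where
  "graph_cycle G xs \<longleftrightarrow>
     walk G xs \<and> distinct xs \<and> 3 \<le> length xs \<and> {last xs, hd xs} \<in> edges G"

text \<open>The infimum of the empty set of type \<^typ>\<open>enat\<close> is \<open>\<infinity>\<close>: acyclic graphs have girth \<open>\<infinity>\<close>,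
  and vertices not joined by a walk are at distance \<open>\<infinity>\<close>.\<close>

definition girth :: "'a ugraph \<Rightarrow> enat" where
  "girth G = (INF xs\<in>{xs. graph_cycle G xs}. enat (length xs))"

definition graph_dist :: "'a ugraph \<Rightarrow> 'a \<Rightarrow> 'a \<Rightarrow> enat" where
  "graph_dist G u v =
     (INF xs\<in>{xs. walk G xs \<and> hd xs = u \<and> last xs = v}. enat (length xs - 1))"

definition graph_diam :: "'a ugraph \<Rightarrow> enat" where
  "graph_diam G = (SUP (u, v)\<in>verts G \<times> verts G. graph_dist G u v)"

text \<open>Planarity is topological: \<open>p\<close> places the vertices at distinct points of the plane and
  \<open>\<gamma> e\<close> is a simple arc joining the two ends of the edge \<open>e\<close>; an arc meets no vertex
  other than its ends, and two arcs meet only in common ends.\<close>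

definition plane_drawing ::
  "'a ugraph \<Rightarrow> ('a \<Rightarrow> complex) \<Rightarrow> ('a set \<Rightarrow> real \<Rightarrow> complex) \<Rightarrow> bool" where
  "plane_drawing G p \<gamma> \<longleftrightarrow>
     inj_on p (verts G) \<and>
     (\<forall>e\<in>edges G. arc (\<gamma> e) \<and> {pathstart (\<gamma> e), pathfinish (\<gamma> e)} = p ` e \<and>
                  path_image (\<gamma> e) \<inter> p ` verts G = p ` e) \<and>
     (\<forall>e\<in>edges G. \<forall>f\<in>edges G. e \<noteq> f \<longrightarrow>
        path_image (\<gamma> e) \<inter> path_image (\<gamma> f) \<subseteq> p ` (e \<inter> f))"

definition planar :: "'a ugraph \<Rightarrow> bool" where
  "planar G \<longleftrightarrow> (\<exists>p \<gamma>. plane_drawing G p \<gamma>)"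

text \<open>An orientation is identified with its set of arcs: exactly one of \<open>(u, v)\<close>, \<open>(v, u)\<close>
  for every edge \<open>{u, v}\<close>, and nothing else.\<close>

definition orientations :: "'a ugraph \<Rightarrow> ('a \<times> 'a) set set" where
  "orientations G =
     {D. (\<forall>(u, v)\<in>D. {u, v} \<in> edges G) \<and>
         (\<forall>u v. {u, v} \<in> edges G \<longrightarrow> ((u, v) \<in> D \<longleftrightarrow> (v, u) \<notin> D))}"

definition inversion :: "'a set \<Rightarrow> ('a \<times> 'a) set \<Rightarrow> ('a \<times> 'a) set" where
  "inversion X D =
     {(u, v). (u, v) \<in> D \<and> \<not> (u \<in> X \<and> v \<in> X)} \<union> {(v, u) | u v. (u, v) \<in> D \<and> u \<in> X \<and> v \<in> X}"

text \<open>Inversions that change nothing would be loops and are left out.\<close>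

definition inversion_graph :: "'a ugraph \<Rightarrow> ('a \<times> 'a) set ugraph" where
  "inversion_graph G =
     \<lparr>verts = orientations G,
      edges = {{D, inversion X D} | D X.
                 D \<in> orientations G \<and> X \<subseteq> verts G \<and> inversion X D \<noteq> D}\<rparr>"

lemma inversion_orientations:
  assumes "D \<in> orientations G"
  shows "inversion X D \<in> orientations G"
proof -
  have sym: "{u, v} \<in> edges G \<longleftrightarrow> {v, u} \<in> edges G" for u v
    by (metis insert_commute)
  have arc_edge: "{u, v} \<in> edges G" if "(u, v) \<in> D" for u v
    using assms that unfolding orientations_def by blast
  have one: "(u, v) \<in> D \<longleftrightarrow> (v, u) \<notin> D" if "{u, v} \<in> edges G" for u v
    using assms that unfolding orientations_def by blast
  have mem: "(u, v) \<in> inversion X D \<longleftrightarrow> (if u \<in> X \<and> v \<in> X then (v, u) \<in> D else (u, v) \<in> D)"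
    for u v
    unfolding inversion_def by auto
  have "{u, v} \<in> edges G" if "(u, v) \<in> inversion X D" for u v
    using that arc_edge sym[of u v] by (metis mem)
  moreover have "(u, v) \<in> inversion X D \<longleftrightarrow> (v, u) \<notin> inversion X D"
    if "{u, v} \<in> edges G" for u v
    using one[OF that] unfolding mem by simp
  ultimately show ?thesis
    unfolding orientations_def by blast
qed

lemma orientations_finite:
  assumes "simple_graph G"
  shows "finite (orientations G)"
proof (rule finite_subset)
  show "orientations G \<subseteq> Pow (verts G \<times> verts G)"
  proof (intro subsetI PowI)
    fix D a
    assume "D \<in> orientations G" and "a \<in> D"
    then have "{fst a, snd a} \<in> edges G"
      unfolding orientations_def by (auto simp: case_prod_beta)
    then have "{fst a, snd a} \<subseteq> verts G"
      using assms unfolding simple_graph_def by blast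
    then show "a \<in> verts G \<times> verts G"
      by (simp add: mem_Times_iff)
  qed
  show "finite (Pow (verts G \<times> verts G))"
    using assms unfolding simple_graph_def by simp
qed

lemma simple_graph_inversion_graph:
  assumes "simple_graph G"
  shows "simple_graph (inversion_graph G)"
proof -
  have "e \<subseteq> orientations G \<and> card e = 2" if edge: "e \<in> edges (inversion_graph G)" for e
  proof -
    obtain D X where e: "e = {D, inversion X D}" and D: "D \<in> orientations G"
      and "inversion X D \<noteq> D"
      using edge unfolding inversion_graph_def by auto
    then have "card e = 2"
      by simp
    then show ?thesis
      using e D inversion_orientations[OF D] by simp
  qed
  then show ?thesis
    using orientations_finite[OF assms]
    unfolding simple_graph_def by (simp add: inversion_graph_def)
qed

end

theory Submission
  imports Defs "HOL-Library.Z2"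
begin

text \<open>Give every vertex \<open>u\<close> a vector \<open>x u\<close> of seven bits. The seven coordinates are seven sets of
  vertices, and inverting all of them reverses exactly the edges \<open>uv\<close> whose ends have odd inner
  product. So it suffices to realise every prescription \<open>\<pi>\<close> of bits on the edges as
  \<open>x u \<bullet> x v = \<pi> uv\<close> (\<open>diam_le_of_vectors\<close>).

  The vectors are chosen one vertex at a time. When \<open>U\<close> is the set of vertices that have a vector,
  the invariant is that every vertex outside \<open>U\<close> sees linearly independent vectors in \<open>U\<close>. The
  next vertex \<open>v\<close>, with \<open>b\<close> neighbours among those already treated, then has exactly \<open>2^(7 - b)\<close>
  vectors meeting its edge constraints (\<open>card_solutions\<close>), and the invariant survives unless the
  vector chosen is a sum of vectors of other treated neighbours of some untreated neighbour of \<open>v\<close>.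
  Each such sum is indexed by a member of \<open>forbidden\<close>, so a choice exists as long as there are
  fewer than \<open>2^(7 - b)\<close> of these (\<open>greedy_vectors\<close>).

  The order is built from its end: given the set \<open>U\<close> of vertices not yet placed, some \<open>v\<close> in \<open>U\<close>
  must be suitable as the last one. This is where planarity and girth enter
  (\<open>good_vertex\<close>). Let \<open>n = |U|\<close>, let \<open>b(v)\<close> and \<open>k(w)\<close> be the numbers of neighbours in \<open>U\<close> of
  \<open>v \<in> U\<close> and \<open>w \<notin> U\<close>; all \<open>k(w) \<le> 4\<close>. A vertex \<open>w\<close> with \<open>k(w) \<ge> 3\<close> contributes
  \<open>k(w) (2^(k(w) - 1) - 1) \<le> 14 (k(w) - 2)\<close> nonempty forbidden sets in total, and Euler's formula for
  the triangle-free graph of the edges inside \<open>U\<close> and from \<open>U\<close> to these \<open>w\<close> bounds \<open>\<Sum> (k(w) - 2)\<close>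
  by \<open>2 n - \<Sum> b(v) / 2\<close>. The vertices with \<open>k(w) = 2\<close> count only through the pairs that they see;
  one vertex for each pair gives a planar graph of girth at least \<open>6\<close>, and Euler's formula leaves
  room for at most \<open>3 n\<close> pairs. Adding up, the average of \<open>|forbidden| + 7 b(v)\<close> over \<open>U\<close> is below \<open>35\<close>, and \<open>f < 35 - 7 b\<close> forces \<open>b \<le> 4\<close> and
  \<open>f < 2^(7 - b)\<close>.

  Euler's formula is derived for topological drawings, with the components of the complement as
  faces. An edge closing a cycle increases the number of faces, by the Jordan curve theorem
  (\<open>chord_splits_complement\<close>); an edge borders at most two faces (\<open>edge_borders_two_faces\<close>) and, if
  there are two faces, the edges bordering a face contain a cycle
  (\<open>acyclic_boundary_only_face\<close>), both by Janiszewski's theorem. Counting pairs of an edge and a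
  face it borders gives \<open>edge_bound_by_girth\<close>.\<close>

section \<open>Arcs in the plane and the components they separate\<close>

text \<open>The inverse of the arc would embed a plane open set into the line, against invariance of
  dimension.\<close>

lemma interior_arc_image_empty:
  fixes g :: "real \<Rightarrow> complex"
  assumes "arc g"
  shows "interior (path_image g) = {}"
proof (rule ccontr)
  let ?U = "interior (path_image g)"
  assume ne: "?U \<noteq> {}"
  obtain h where h: "homeomorphism {0..1} (path_image g) g h"
    using homeomorphism_arc[OF assms] by blast
  have "continuous_on ?U h"
    using h interior_subset continuous_on_subset unfolding homeomorphism_def by blast
  moreover have "inj_on h ?U"
    using h interior_subset unfolding homeomorphism_def inj_on_def by (metis subset_iff)
  ultimately have "DIM(complex) \<le> DIM(real)"
    using invariance_of_dimension[of ?U h] ne by auto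
  then show False by simp
qed

lemma arc_midpoint_not_end:
  assumes "arc g"
  shows "g (1/2) \<in> path_image g - {pathstart g, pathfinish g}"
proof -
  have inj: "inj_on g {0..1}" using assms unfolding arc_def by blast
  have "g (1/2) \<noteq> g 0" "g (1/2) \<noteq> g 1"
    using inj_onD[OF inj, of "1/2" 0] inj_onD[OF inj, of "1/2" 1] by auto
  then show ?thesis unfolding path_image_def pathstart_def pathfinish_def by auto
qed

text \<open>The chord \<open>g\<close> and the arc \<open>q\<close> form a Jordan curve. Each side of it comes arbitrarily close to the
  midpoint of \<open>g\<close>, where a small disc avoids \<open>K\<close>: the disc joins the two sides in \<open>- K\<close>, and nothing
  joins them once \<open>g\<close> is removed as well.\<close>

lemma chord_splits_complement:
  fixes g q :: "real \<Rightarrow> complex"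
  assumes K: "compact K" and g: "arc g" and q: "arc q" "path_image q \<subseteq> K"
    and ends: "pathstart q = pathfinish g" "pathfinish q = pathstart g"
    and gK: "path_image g \<inter> K = {pathstart g, pathfinish g}"
  obtains y z where "connected_component (- K) y z" "y \<notin> path_image g" "z \<notin> path_image g"
    "\<not> connected_component (- (K \<union> path_image g)) y z"
proof -
  let ?J = "path_image (g +++ q)"
  have J: "?J = path_image g \<union> path_image q"
    using ends by (simp add: path_image_join)
  have sp: "simple_path (g +++ q)"
    using g q ends gK by (intro simple_path_join_loop) auto
  note io = Jordan_inside_outside[OF sp]
  have io': "inside ?J \<union> outside ?J = - ?J" "frontier (inside ?J) = ?J" "frontier (outside ?J) = ?J"
    "inside ?J \<inter> outside ?J = {}"
    using io ends by (auto simp: pathstart_join pathfinish_join)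
  define x where "x = g (1/2)"
  have x: "x \<in> path_image g" "x \<notin> K"
    using arc_midpoint_not_end[OF g] gK by (auto simp: x_def)
  then obtain r where r: "r > 0" "ball x r \<subseteq> - K"
    using open_contains_ball K compact_imp_closed by (metis ComplI open_Compl)
  have "x \<in> closure (inside ?J)" "x \<in> closure (outside ?J)"
    using x J io'(2,3) closure_Un_frontier by blast+
  then obtain y z where y: "y \<in> inside ?J" "dist y x < r" and z: "z \<in> outside ?J" "dist z x < r"
    using r by (meson closure_approachable)
  show thesis
  proof
    have "y \<in> ball x r" "z \<in> ball x r" using y z by (auto simp: dist_commute)
    then show "connected_component (- K) y z"
      using r connected_ball connected_component_def by metis
    show "y \<notin> path_image g" "z \<notin> path_image g" using y z io'(1) J by blast+
    show "\<not> connected_component (- (K \<union> path_image g)) y z"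
    proof
      assume "connected_component (- (K \<union> path_image g)) y z"
      then obtain T where T: "connected T" "T \<subseteq> - (K \<union> path_image g)" "y \<in> T" "z \<in> T"
        unfolding connected_component_def by blast
      have "T \<inter> inside ?J \<noteq> {}" "T - inside ?J \<noteq> {}" using T y z io'(4) by blast+
      then have "T \<inter> ?J \<noteq> {}" using connected_Int_frontier[OF T(1)] io'(2) by metis
      then show False using T(2) J q(2) by auto
    qed
  qed
qed

text \<open>If \<open>g\<close> is removed from the obstacle, one can walk from one component onto the interior of \<open>g\<close>,
  along it, and off into the other component.\<close>

lemma touching_components_joined:
  fixes g :: "real \<Rightarrow> complex"
  assumes g: "arc g" and gK: "path_image g \<inter> K = {pathstart g, pathfinish g}"
    and F1: "F1 \<in> components (- (K \<union> path_image g))" "closure F1 \<inter> (path_image g - K) \<noteq> {}"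
    and F2: "F2 \<in> components (- (K \<union> path_image g))" "closure F2 \<inter> (path_image g - K) \<noteq> {}"
    and y: "y1 \<in> F1" "y2 \<in> F2"
  shows "connected_component (- K) y1 y2"
proof -
  have eq: "path_image g - K = path_image g - {pathstart g, pathfinish g}" using gK by auto
  have conn: "connected (path_image g - K)"
    unfolding eq using g by (intro connected_simple_path_endless arc_imp_simple_path)
  obtain x1 x2 where x1: "x1 \<in> closure F1" "x1 \<in> path_image g - K"
    and x2: "x2 \<in> closure F2" "x2 \<in> path_image g - K" using F1 F2 by auto
  have "connected F1" "connected F2" using F1 F2 in_components_connected by auto
  then have c: "connected (insert x1 F1)" "connected (insert x2 F2)"
    using x1 x2 connected_intermediate_closure[of F1] connected_intermediate_closure[of F2]
      closure_subset by (metis insert_subset subset_insertI)+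
  have c1: "connected (insert x1 F1 \<union> (path_image g - K))"
    using c conn x1 by (intro connected_Un) auto
  have c2: "connected ((insert x1 F1 \<union> (path_image g - K)) \<union> insert x2 F2)"
    by (rule connected_Un[OF c1 c(2)]) (use x2 in blast)
  moreover have "F1 \<subseteq> - K" "F2 \<subseteq> - K" using F1 F2 in_components_subset by blast+
  ultimately show ?thesis
    using x1 x2 y unfolding connected_component_def
    by (intro exI[of _ "(insert x1 F1 \<union> (path_image g - K)) \<union> insert x2 F2"]) auto
qed

lemma components_eq_if_connected:
  assumes "F1 \<in> components S" "F2 \<in> components S" "y1 \<in> F1" "y2 \<in> F2" "connected_component S y1 y2"
  shows "F1 = F2"
  using assms by (metis components_iff connected_component_eq mem_Collect_eq)

text \<open>Of three components touching \<open>g\<close>, two lie on the same side of the Jordan curve \<open>J\<close> formed by \<open>g\<close> and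
  \<open>q\<close>. Points of these two are joined in \<open>- J\<close> because they are on the same side, and in \<open>- K\<close> because
  both touch \<open>g\<close>. As \<open>J \<inter> K = q\<close> is connected, Janiszewski's theorem joins them in
  \<open>- (J \<union> K)\<close>, so the components agree.\<close>

lemma chord_two_sides:
  fixes g q :: "real \<Rightarrow> complex"
  assumes K: "compact K" and g: "arc g" and q: "arc q" "path_image q \<subseteq> K"
    and ends: "pathstart q = pathfinish g" "pathfinish q = pathstart g"
    and gK: "path_image g \<inter> K = {pathstart g, pathfinish g}"
    and F: "\<And>F. F \<in> {F1, F2, F3} \<Longrightarrow>
      F \<in> components (- (K \<union> path_image g)) \<and> closure F \<inter> (path_image g - K) \<noteq> {}"
  shows "F1 = F2 \<or> F1 = F3 \<or> F2 = F3"
proof -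
  let ?J = "path_image (g +++ q)"
  have J: "?J = path_image g \<union> path_image q"
    using ends by (simp add: path_image_join)
  have sp: "simple_path (g +++ q)"
    using g q ends gK by (intro simple_path_join_loop) auto
  note io = Jordan_inside_outside[OF sp]
  have io': "inside ?J \<union> outside ?J = - ?J" "connected (inside ?J)" "connected (outside ?J)"
    using io ends by (auto simp: pathstart_join pathfinish_join)
  have same_side: "A = B"
    if AB: "A \<in> {F1, F2, F3}" "B \<in> {F1, F2, F3}" "a \<in> A" "b \<in> B"
      and C: "a \<in> C" "b \<in> C" "C \<subseteq> - ?J" "connected C" for A B a b C
  proof -
    have "connected_component (- (?J \<union> K)) a b"
    proof (rule Janiszewski)
      show "compact ?J" using sp by (simp add: compact_simple_path_image)
      show "closed K" using K compact_imp_closed by blast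
      have "?J \<inter> K = (path_image g \<inter> K) \<union> path_image q" using J q(2) by blast
      also have "\<dots> = path_image q"
        using gK ends pathstart_in_path_image[of q] pathfinish_in_path_image[of q] by auto
      finally have "?J \<inter> K = path_image q" .
      then show "connected (?J \<inter> K)" using q connected_arc_image by simp
      show "connected_component (- ?J) a b" using C unfolding connected_component_def by blast
      show "connected_component (- K) a b"
        using touching_components_joined[OF g gK] F AB by metis
    qed
    moreover have "?J \<union> K = K \<union> path_image g" using J q by auto
    ultimately show ?thesis
      using components_eq_if_connected F AB by metis
  qed
  have "\<exists>y. y \<in> A" if "A \<in> {F1, F2, F3}" for A
    using F[OF that] in_components_nonempty by blast
  then obtain y1 y2 y3 where y: "y1 \<in> F1" "y2 \<in> F2" "y3 \<in> F3" by blast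
  have "y \<in> - ?J" if "A \<in> {F1, F2, F3}" "y \<in> A" for y A
    using F[OF that(1)] that(2) in_components_subset J q by blast
  then have "y1 \<in> inside ?J \<union> outside ?J" "y2 \<in> inside ?J \<union> outside ?J" "y3 \<in> inside ?J \<union> outside ?J"
    using io'(1) y by blast+
  moreover have "inside ?J \<subseteq> - ?J" "outside ?J \<subseteq> - ?J" using io'(1) by blast+
  ultimately show ?thesis
    using same_side y io'(2,3) by (metis UnE insert_iff)
qed

text \<open>Janiszewski's theorem needs a connected intersection, and \<open>g\<close> meets \<open>K1 \<union> K2\<close> in two points; but
  adding \<open>K1\<close> and then \<open>K2\<close> to \<open>g\<close> meets a single point each time.\<close>

lemma bridge_keeps_connected:
  fixes g :: "real \<Rightarrow> complex"
  assumes g: "arc g" and K: "compact K1" "compact K2"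
    and gK: "path_image g \<inter> K1 = {a}" "path_image g \<inter> K2 = {b}" and disj: "K1 \<inter> K2 = {}"
    and yz: "connected_component (- (K1 \<union> K2)) y z" "y \<notin> path_image g" "z \<notin> path_image g"
  shows "connected_component (- (K1 \<union> K2 \<union> path_image g)) y z"
proof -
  have g_compl: "connected_component (- path_image g) y z"
    using connected_arc_complement[OF g] yz by (simp add: connected_iff_connected_component)
  have "connected_component (- (path_image g \<union> K1)) y z"
  proof (rule Janiszewski[OF _ _ _ g_compl])
    show "compact (path_image g)" using g compact_arc_image by blast
    show "closed K1" using K compact_imp_closed by blast
    show "connected (path_image g \<inter> K1)" using gK by simp
    show "connected_component (- K1) y z"
      using yz(1) connected_component_mono[of "- (K1 \<union> K2)" "- K1"] by (auto simp: le_fun_def)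
  qed
  then have "connected_component (- ((path_image g \<union> K1) \<union> K2)) y z"
  proof (rule Janiszewski[rotated 3])
    show "compact (path_image g \<union> K1)" using g K compact_arc_image by blast
    show "closed K2" using K compact_imp_closed by blast
    have "(path_image g \<union> K1) \<inter> K2 = {b}" using gK disj by blast
    then show "connected ((path_image g \<union> K1) \<inter> K2)" by simp
    show "connected_component (- K2) y z"
      using yz(1) connected_component_mono[of "- (K1 \<union> K2)" "- K2"] by (auto simp: le_fun_def)
  qed
  moreover have "(path_image g \<union> K1) \<union> K2 = K1 \<union> K2 \<union> path_image g" by blast
  ultimately show ?thesis by metis
qed

lemma card_le_2I:
  assumes "\<And>a b c. a \<in> A \<Longrightarrow> b \<in> A \<Longrightarrow> c \<in> A \<Longrightarrow> a = b \<or> a = c \<or> b = c"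
  shows "finite A \<and> card A \<le> 2"
proof (cases "\<exists>a b. a \<in> A \<and> b \<in> A \<and> a \<noteq> b")
  case True
  then obtain a b where ab: "a \<in> A" "b \<in> A" "a \<noteq> b" by blast
  then have "A = {a, b}" using assms by blast
  then show ?thesis using card_insert_le_m1[of 2 "{b}" a] by simp
next
  case False
  show ?thesis
  proof (cases "A = {}")
    case nonempty: False
    then obtain a where "A = {a}" using \<open>\<not> (\<exists>a b. _ a b)\<close> by blast
    then show ?thesis by simp
  qed simp
qed

section \<open>Connection, forests and cycles in graphs\<close>

definition joined :: "'a set set \<Rightarrow> 'a \<Rightarrow> 'a \<Rightarrow> bool" where
  "joined F u v \<longleftrightarrow> (u, v) \<in> {(a, b). {a, b} \<in> F}\<^sup>*"

lemma joined_refl: "joined F u u"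
  unfolding joined_def by simp

lemma joined_step: "joined F u a \<Longrightarrow> {a, b} \<in> F \<Longrightarrow> joined F u b"
  unfolding joined_def by (metis (mono_tags, lifting) case_prodI mem_Collect_eq rtrancl.simps)

lemma joined_mono: "joined F u v \<Longrightarrow> F \<subseteq> F' \<Longrightarrow> joined F' u v"
  unfolding joined_def by (erule rtrancl_mono[THEN subsetD, rotated]) blast

lemma joined_class_splits:
  assumes "f \<subseteq> V" "card f = 2" "f \<in> F"
  shows "f \<subseteq> {w \<in> V. joined F u w} \<or> f \<subseteq> V - {w \<in> V. joined F u w}"
proof -
  obtain a b where f: "f = {a, b}" using assms(2) by (meson card_2_iff)
  then have "joined F u a \<longleftrightarrow> joined F u b"
    using joined_step[of F u] assms(3) by (metis insert_commute)
  then show ?thesis using assms f by auto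
qed

text \<open>Here a forest is given by the property that every edge is a bridge. Removing an edge splits the
  vertices into the part reachable from one end and the rest, and the bound holds in both parts.\<close>

lemma forest_card:
  assumes "finite V" "V \<noteq> {}" "\<And>e. e \<in> F \<Longrightarrow> e \<subseteq> V \<and> card e = 2"
    and "\<And>u v. {u, v} \<in> F \<Longrightarrow> \<not> joined (F - {{u, v}}) u v"
  shows "card F + 1 \<le> card V"
  using assms
proof (induction "card V" arbitrary: V F rule: less_induct)
  case less
  have finF: "finite F"
    using less.prems(1,3) finite_subset[of F "Pow V"] by blast
  show ?case
  proof (cases "F = {}")
    case True
    then show ?thesis using less.prems(1,2) by (simp add: Suc_leI card_gt_0_iff)
  next
    case False
    then obtain e where e: "e \<in> F" by blast
    then obtain u v where uv: "e = {u, v}" "u \<noteq> v" using less.prems(3) by (meson card_2_iff)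
    define A where "A = {w \<in> V. joined (F - {e}) u w}"
    define B where "B = V - A"
    have uA: "u \<in> A" using less.prems(3) e uv joined_refl by (auto simp: A_def)
    have vB: "v \<in> B" using less.prems(3,4) e uv by (auto simp: A_def B_def)
    have AB: "A \<union> B = V" "A \<inter> B = {}" by (auto simp: A_def B_def)
    define FA FB where "FA = {f \<in> F - {e}. f \<subseteq> A}" and "FB = {f \<in> F - {e}. f \<subseteq> B}"
    have split: "f \<subseteq> A \<or> f \<subseteq> B" if "f \<in> F - {e}" for f
      using joined_class_splits[of f V "F - {e}" u] that less.prems(3)[of f] by (auto simp: A_def B_def)
    have "FA \<union> FB = F - {e}" using split unfolding FA_def FB_def by blast
    then have F: "F = insert e (FA \<union> FB)" "e \<notin> FA \<union> FB" using e by blast+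
    have disj: "FA \<inter> FB = {}"
    proof (rule ccontr)
      assume "FA \<inter> FB \<noteq> {}"
      then obtain f where "f \<in> F" "f \<subseteq> A" "f \<subseteq> B" unfolding FA_def FB_def by blast
      then have "f = {}" "card f = 2" using AB less.prems(3) by blast+
      then show False by simp
    qed
    have finA: "finite A" "finite B" using less.prems(1) AB by (metis finite_Un)+
    have cV: "card V = card A + card B" using AB finA by (metis card_Un_disjoint)
    have pos: "card A > 0" "card B > 0" using uA vB finA by (auto simp: card_gt_0_iff)
    have sub: "FA \<subseteq> F" "FB \<subseteq> F" by (auto simp: FA_def FB_def)
    have noj: "\<not> joined (F' - {{a, b}}) a b" if "F' \<subseteq> F" "{a, b} \<in> F'" for F' a b
      using less.prems(4)[of a b] joined_mono[of "F' - {{a, b}}" a b "F - {{a, b}}"] that by blast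
    have cA: "card FA + 1 \<le> card A"
    proof (rule less.hyps)
      show "card A < card V" "finite A" "A \<noteq> {}" using cV pos finA uA by auto
    qed (use less.prems(3) noj sub in \<open>auto simp: FA_def\<close>)
    have cB: "card FB + 1 \<le> card B"
    proof (rule less.hyps)
      show "card B < card V" "finite B" "B \<noteq> {}" using cV pos finA vB by auto
    qed (use less.prems(3) noj sub in \<open>auto simp: FB_def\<close>)
    have "card F = card FA + card FB + 1"
      using F disj finF card_Un_disjoint[of FA FB] by simp
    then show ?thesis using cA cB cV by simp
  qed
qed

lemma joined_path:
  assumes "joined F u v" "u \<in> V" "\<And>f. f \<in> F \<Longrightarrow> f \<subseteq> V"
  obtains xs where "walk \<lparr>verts = V, edges = F\<rparr> xs" "distinct xs" "hd xs = u" "last xs = v"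
proof -
  have "\<exists>xs. walk \<lparr>verts = V, edges = F\<rparr> xs \<and> distinct xs \<and> hd xs = u \<and> last xs = v"
    using assms(1) unfolding joined_def
  proof (induction rule: rtrancl_induct)
    case base
    show ?case using assms(2) by (intro exI[of _ "[u]"]) (simp add: walk_def)
  next
    case (step y z)
    then obtain xs where xs: "walk \<lparr>verts = V, edges = F\<rparr> xs" "distinct xs" "hd xs = u" "last xs = y"
      by blast
    have yz: "{y, z} \<in> F" using step by simp
    show ?case
    proof (cases "z \<in> set xs")
      case True
      \<comment> \<open>The path already passes through \<open>z\<close>: cut it there.\<close>
      then obtain as bs where "xs = as @ z # bs" by (meson split_list)
      then have split: "xs = (as @ [z]) @ bs" by simp
      then have "walk \<lparr>verts = V, edges = F\<rparr> (as @ [z])"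
        using xs(1) unfolding walk_def by (simp only: successively_append_iff) auto
      moreover have "hd (as @ [z]) = u" using xs(3) split by (cases as) auto
      ultimately show ?thesis using xs(2) split by (intro exI[of _ "as @ [z]"]) simp
    next
      case False
      then show ?thesis using xs yz assms(3)[OF yz]
        by (intro exI[of _ "xs @ [z]"]) (auto simp: walk_def successively_append_iff)
    qed
  qed
  then show thesis using that by blast
qed

lemma joined_closes_cycle:
  assumes j: "joined F u v" and V: "u \<in> V" "u \<noteq> v" "{u, v} \<notin> F" and F: "\<And>f. f \<in> F \<Longrightarrow> f \<subseteq> V"
  shows "\<exists>xs. graph_cycle \<lparr>verts = V, edges = insert {u, v} F\<rparr> xs"
proof -
  obtain xs where xs: "walk \<lparr>verts = V, edges = F\<rparr> xs" "distinct xs" "hd xs = u" "last xs = v"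
    using joined_path[OF j V(1)] F by blast
  have "3 \<le> length xs"
  proof (rule ccontr)
    assume "\<not> 3 \<le> length xs"
    moreover have "length xs \<noteq> 0" using xs(1) by (simp add: walk_def)
    ultimately have "length xs = 1 \<or> length xs = 2" by linarith
    then show False
      using xs V by (auto simp: walk_def length_Suc_conv numeral_2_eq_2)
  qed
  moreover have "walk \<lparr>verts = V, edges = insert {u, v} F\<rparr> xs"
    using xs(1) unfolding walk_def by (auto elim: successively_mono)
  ultimately show ?thesis using xs by (auto simp: graph_cycle_def insert_commute)
qed

lemma graph_cycle_mono:
  assumes "graph_cycle \<lparr>verts = W, edges = F\<rparr> xs" "W \<subseteq> verts G" "F \<subseteq> edges G"
  shows "graph_cycle G xs"
  using assms unfolding graph_cycle_def walk_def by (auto elim!: successively_mono)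

text \<open>Sending a component of \<open>- (K \<union> L)\<close> to the component of \<open>- K\<close> around it is onto, since a component
  of \<open>- K\<close> is open and \<open>L\<close> has no interior, and it identifies the components of \<open>y\<close> and \<open>z\<close>.\<close>

lemma card_components_increases:
  fixes K L :: "complex set"
  assumes K: "closed K" and L: "interior L = {}"
    and fin: "finite (components (- (K \<union> L)))"
    and yz: "connected_component (- K) y z" "y \<notin> L" "z \<notin> L"
      "\<not> connected_component (- (K \<union> L)) y z"
  shows "card (components (- K)) < card (components (- (K \<union> L)))"
proof -
  define \<phi> where "\<phi> D = connected_component_set (- K) (SOME x. x \<in> D)" for D
  let ?C = "components (- (K \<union> L))"
  have \<phi>: "\<phi> D = connected_component_set (- K) x" if D: "D \<in> ?C" "x \<in> D" for D x
  proof -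
    have "(SOME x. x \<in> D) \<in> D" using D(2) by (rule someI)
    moreover have "connected D" "D \<subseteq> - K"
      using D in_components_connected in_components_subset by blast+
    ultimately have "connected_component (- K) (SOME x. x \<in> D) x"
      using D(2) unfolding connected_component_def by blast
    then show ?thesis unfolding \<phi>_def by (intro connected_component_eq[symmetric]) simp
  qed
  have img: "\<phi> ` ?C = components (- K)"
  proof (intro equalityI subsetI)
    fix C assume "C \<in> \<phi> ` ?C"
    then obtain D where D: "D \<in> ?C" "C = \<phi> D" by blast
    then obtain x where "x \<in> D" using in_components_nonempty by blast
    then show "C \<in> components (- K)"
      using \<phi> D in_components_subset by (metis ComplD ComplI UnI1 componentsI subsetD)
  next
    fix C assume C: "C \<in> components (- K)"
    then have "open C" "C \<noteq> {}" using K open_components in_components_nonempty by blast+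
    then have "\<not> C \<subseteq> L" using L interior_maximal by blast
    then obtain x where x: "x \<in> C" "x \<notin> L" by blast
    have xK: "x \<in> - K" using C x in_components_subset by blast
    let ?D = "connected_component_set (- (K \<union> L)) x"
    have D: "?D \<in> ?C" "x \<in> ?D" using x xK by (auto intro: componentsI)
    have "C = connected_component_set (- K) x"
      using C x by (metis components_iff connected_component_eq)
    then have "C = \<phi> ?D" using \<phi>[OF D] by simp
    then show "C \<in> \<phi> ` ?C" using D by blast
  qed
  have le: "card (components (- K)) \<le> card ?C"
    using card_image_le[OF fin, of \<phi>] img by simp
  have ynz: "y \<in> - (K \<union> L)" "z \<in> - (K \<union> L)" using yz connected_component_in by fastforce+
  let ?D = "\<lambda>x. connected_component_set (- (K \<union> L)) x"
  have D: "?D y \<in> ?C" "y \<in> ?D y" "?D z \<in> ?C" "z \<in> ?D z"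
    using ynz by (auto intro: componentsI)
  have "?D y \<noteq> ?D z" using D(4) yz(4) by auto
  moreover have "\<phi> (?D y) = \<phi> (?D z)"
    using \<phi>[OF D(1,2)] \<phi>[OF D(3,4)] connected_component_eq[of z "- K" y] yz(1) by simp
  ultimately have "\<not> inj_on \<phi> ?C" using D unfolding inj_on_def by blast
  then have "card (\<phi> ` ?C) \<noteq> card ?C" using eq_card_imp_inj_on[OF fin] by blast
  then show "card (components (- K)) < card ?C" using le img by simp
qed

lemma components_connected_subset:
  assumes "connected S"
  shows "components S \<subseteq> {S}"
proof (cases "S = {}")
  case False
  then show ?thesis using assms components_eq_sing_iff[of S] by simp
qed simp

text \<open>Consecutive vertices span pairwise distinct edges, because the cycle has at least three vertices.\<close>

lemma graph_cycle_length_le: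
  assumes c: "graph_cycle \<lparr>verts = W, edges = F\<rparr> xs" and F: "finite F"
  shows "length xs \<le> card F"
proof -
  let ?n = "length xs"
  define s where "s i = (if Suc i = ?n then 0 else Suc i)" for i
  have xs: "distinct xs" "3 \<le> ?n" "{last xs, hd xs} \<in> F" "xs \<noteq> []"
    "\<And>i. Suc i < ?n \<Longrightarrow> {xs ! i, xs ! Suc i} \<in> F"
    using c by (auto simp: graph_cycle_def walk_def successively_conv_nth)
  have sn: "s i < ?n" if "i < ?n" for i using that by (auto simp: s_def)
  have "(\<lambda>i. {xs ! i, xs ! s i}) ` {..<?n} \<subseteq> F"
  proof (intro image_subsetI)
    fix i assume i: "i \<in> {..<?n}"
    show "{xs ! i, xs ! s i} \<in> F"
    proof (cases "Suc i = ?n")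
      case True
      then have "i = ?n - 1" by simp
      then show ?thesis using xs(3,4) True by (simp add: s_def last_conv_nth hd_conv_nth)
    next
      case False
      then show ?thesis using xs(5)[of i] i by (simp add: s_def)
    qed
  qed
  moreover have "inj_on (\<lambda>i. {xs ! i, xs ! s i}) {..<?n}"
  proof (rule inj_onI)
    fix i j assume ij: "i \<in> {..<?n}" "j \<in> {..<?n}" "{xs ! i, xs ! s i} = {xs ! j, xs ! s j}"
    \<comment> \<open>The second case would make \<open>i\<close> its own second successor, on a cycle of length at least \<open>3\<close>.\<close>
    then have "i = j \<or> (i = s j \<and> s i = j)"
      using sn[of i] sn[of j] xs(1) by (auto simp: doubleton_eq_iff nth_eq_iff_index_eq)
    then show "i = j" using ij(1,2) xs(2) unfolding s_def by (auto split: if_splits)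
  qed
  ultimately have "card {..<?n} \<le> card F" using card_inj_on_le F by blast
  then show ?thesis by simp
qed

section \<open>Faces of plane drawings and Euler's inequality\<close>

locale plane_graph =
  fixes V :: "'a set" and E :: "'a set set" and p :: "'a \<Rightarrow> complex"
    and \<gamma> :: "'a set \<Rightarrow> real \<Rightarrow> complex"
  assumes simple: "simple_graph \<lparr>verts = V, edges = E\<rparr>"
    and drawing: "plane_drawing \<lparr>verts = V, edges = E\<rparr> p \<gamma>"
begin

text \<open>Vertices and edges vary independently: faces are taken with all vertices drawn, while the two
  sides of a bridge are drawn separately.\<close>

definition drawn :: "'a set \<Rightarrow> 'a set set \<Rightarrow> complex set" where
  "drawn W F = p ` W \<union> (\<Union>e\<in>F. path_image (\<gamma> e))"

abbreviation faces :: "'a set set \<Rightarrow> complex set set" where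
  "faces F \<equiv> components (- drawn V F)"

text \<open>The vertices are taken out of the edges, so that an edge does not count as bordering every face
  that reaches one of its ends.\<close>

definition boundary_edges :: "'a set set \<Rightarrow> complex set \<Rightarrow> 'a set set" where
  "boundary_edges F C = {e \<in> F. closure C \<inter> (path_image (\<gamma> e) - p ` V) \<noteq> {}}"

lemma fin_V: "finite V" and edgeD: "e \<in> E \<Longrightarrow> e \<subseteq> V \<and> card e = 2"
  using simple by (auto simp: simple_graph_def)

lemma fin_E: "finite E"
  using fin_V edgeD by (meson PowI finite_Pow_iff finite_subset subsetI)

lemma inj_p: "inj_on p V"
  using drawing by (simp add: plane_drawing_def)

lemma arc_edge: "e \<in> E \<Longrightarrow> arc (\<gamma> e)"
  and edge_verts: "e \<in> E \<Longrightarrow> path_image (\<gamma> e) \<inter> p ` V = p ` e"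
  and edge_ends: "e \<in> E \<Longrightarrow> {pathstart (\<gamma> e), pathfinish (\<gamma> e)} = p ` e"
  and edge_edge: "e \<in> E \<Longrightarrow> f \<in> E \<Longrightarrow> e \<noteq> f \<Longrightarrow> path_image (\<gamma> e) \<inter> path_image (\<gamma> f) \<subseteq> p ` (e \<inter> f)"
  using drawing by (auto simp: plane_drawing_def)

lemma obtain_ends:
  assumes "e \<in> E"
  obtains u v where "e = {u, v}" "u \<noteq> v" "u \<in> V" "v \<in> V" "pathstart (\<gamma> e) = p u" "pathfinish (\<gamma> e) = p v"
proof -
  obtain u v where uv: "e = {u, v}" "u \<noteq> v" using edgeD[OF assms] by (meson card_2_iff)
  then have "{pathstart (\<gamma> e), pathfinish (\<gamma> e)} = {p u, p v}" using edge_ends[OF assms] by simp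
  then show thesis using that[of u v] that[of v u] uv edgeD[OF assms]
    by (auto simp: doubleton_eq_iff insert_commute)
qed

lemma compact_drawn:
  assumes "W \<subseteq> V" "F \<subseteq> E"
  shows "compact (drawn W F)"
proof -
  have "finite W" "finite F" using assms fin_V fin_E finite_subset by blast+
  then have "compact (p ` W)" "compact (\<Union>e\<in>F. path_image (\<gamma> e))"
    using assms(2) arc_edge by (simp add: finite_imp_compact, intro compact_UN) (auto intro: compact_arc_image)
  then show ?thesis unfolding drawn_def by (rule compact_Un)
qed

lemma edge_Int_drawn:
  assumes "e \<in> E" "F \<subseteq> E" "e \<notin> F" "W \<subseteq> V" "\<And>f. f \<in> F \<Longrightarrow> f \<subseteq> W"
  shows "path_image (\<gamma> e) \<inter> drawn W F = p ` (e \<inter> W)"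
proof (intro equalityI subsetI)
  fix x assume x: "x \<in> path_image (\<gamma> e) \<inter> drawn W F"
  consider "x \<in> p ` W" | f where "f \<in> F" "x \<in> path_image (\<gamma> f)" using x unfolding drawn_def by blast
  then show "x \<in> p ` (e \<inter> W)"
  proof cases
    case 1
    then have "x \<in> p ` e" using x edge_verts[OF assms(1)] assms(4) by blast
    then show ?thesis
      using 1 inj_p edgeD[OF assms(1)] assms(4) by (metis IntI inj_on_image_Int)
  next
    case 2
    then have "x \<in> p ` (e \<inter> f)" using x edge_edge[of e f] assms by blast
    then show ?thesis using 2 assms(5) by blast
  qed
next
  fix x assume "x \<in> p ` (e \<inter> W)"
  then show "x \<in> path_image (\<gamma> e) \<inter> drawn W F"
    using edge_verts[OF assms(1)] unfolding drawn_def by blast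
qed

lemma edge_Int_drawn_V:
  assumes "e \<in> E" "F \<subseteq> E" "e \<notin> F"
  shows "path_image (\<gamma> e) \<inter> drawn V F = {pathstart (\<gamma> e), pathfinish (\<gamma> e)}"
proof -
  have "e \<inter> V = e" using edgeD[OF assms(1)] by blast
  moreover have "f \<subseteq> V" if "f \<in> F" for f using that assms edgeD by blast
  ultimately show ?thesis using edge_Int_drawn[OF assms, of V] edge_ends[OF assms(1)] by simp
qed

lemma drawn_insert: "drawn W (insert e F) = drawn W F \<union> path_image (\<gamma> e)"
  unfolding drawn_def by blast

lemma joined_arc:
  assumes F: "F \<subseteq> E" and j: "joined F u v" and uv: "u \<in> V" "v \<in> V" "u \<noteq> v"
  obtains q where "arc q" "path_image q \<subseteq> drawn V F" "pathstart q = p u" "pathfinish q = p v"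
proof -
  have "path_component (drawn V F) (p u) (p v)"
    using j unfolding joined_def
  proof (induction rule: rtrancl_induct)
    case base
    show ?case using uv by (simp add: path_component_refl drawn_def)
  next
    case (step a b)
    then have ab: "{a, b} \<in> F" by simp
    then have "p a \<in> path_image (\<gamma> {a, b})" "p b \<in> path_image (\<gamma> {a, b})"
      using edge_verts[of "{a, b}"] F by blast+
    moreover have "path_connected (path_image (\<gamma> {a, b}))"
      using arc_edge ab F by (meson arc_imp_path path_connected_path_image subsetD)
    ultimately have "path_component (path_image (\<gamma> {a, b})) (p a) (p b)"
      by (simp add: path_connected_component)
    then have "path_component (drawn V F) (p a) (p b)"
      using path_component_of_subset[of "path_image (\<gamma> {a, b})" "drawn V F"] ab
      unfolding drawn_def by blast
    then show ?case using step.IH path_component_trans by blast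
  qed
  then obtain g where g: "path g" "path_image g \<subseteq> drawn V F" "pathstart g = p u" "pathfinish g = p v"
    unfolding path_component_def by blast
  moreover have "p u \<noteq> p v" using inj_p uv by (meson inj_onD)
  ultimately show thesis using path_contains_arc[of g "p u" "p v"] that by (metis subset_trans)
qed

text \<open>When \<open>e\<close> would connect two components of the graph, the drawing falls apart into the part
  connected to \<open>u\<close> and the rest.\<close>

lemma unjoined_split:
  assumes F: "F \<subseteq> E" and e: "e \<in> E" "e \<notin> F" "e = {u, v}" and nj: "\<not> joined F u v"
  obtains K1 K2 where "compact K1" "compact K2" "K1 \<inter> K2 = {}" "K1 \<union> K2 = drawn V F"
    "path_image (\<gamma> e) \<inter> K1 = {p u}" "path_image (\<gamma> e) \<inter> K2 = {p v}"
proof -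
  define A where "A = {w \<in> V. joined F u w}"
  define B where "B = V - A"
  define FA FB where "FA = {f \<in> F. f \<subseteq> A}" and "FB = {f \<in> F. f \<subseteq> B}"
  have AB: "A \<subseteq> V" "B \<subseteq> V" "A \<union> B = V" "A \<inter> B = {}" by (auto simp: A_def B_def)
  have uv: "u \<in> A" "v \<in> B" using e nj edgeD[OF e(1)] joined_refl by (auto simp: A_def B_def)
  have sub: "FA \<subseteq> E" "FB \<subseteq> E" "e \<notin> FA" "e \<notin> FB" using F e by (auto simp: FA_def FB_def)
  have "f \<subseteq> A \<or> f \<subseteq> B" if "f \<in> F" for f
    using joined_class_splits[of f V F u] that F edgeD[of f] unfolding A_def B_def by blast
  then have FAB: "F = FA \<union> FB" unfolding FA_def FB_def by blast
  show thesis
  proof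
    show "compact (drawn A FA)" "compact (drawn B FB)" using compact_drawn AB sub by auto
    show "drawn A FA \<union> drawn B FB = drawn V F" using AB FAB unfolding drawn_def by blast
    have "path_image (\<gamma> f) \<inter> drawn B FB = {}" if f: "f \<in> FA" for f
    proof -
      have "f \<subseteq> A" "f \<noteq> {}" using f sub edgeD[of f] by (auto simp: FA_def)
      then have "f \<notin> FB" using AB by (auto simp: FB_def)
      then have "path_image (\<gamma> f) \<inter> drawn B FB = p ` (f \<inter> B)"
        using f sub AB by (intro edge_Int_drawn) (auto simp: FB_def)
      then show ?thesis using \<open>f \<subseteq> A\<close> AB by auto
    qed
    moreover have "p ` A \<inter> drawn B FB = {}"
    proof -
      have "p ` A \<inter> p ` B = {}" using inj_on_image_Int[OF inj_p AB(1,2)] AB(4) by simp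
      moreover have "p ` A \<inter> path_image (\<gamma> f) = {}" if "f \<in> FB" for f
      proof -
        have "path_image (\<gamma> f) \<inter> p ` V = p ` f" "f \<subseteq> B" using edge_verts[of f] that sub unfolding FB_def by blast+
        then show ?thesis using \<open>p ` A \<inter> p ` B = {}\<close> AB by blast
      qed
      ultimately show ?thesis unfolding drawn_def by blast
    qed
    ultimately show "drawn A FA \<inter> drawn B FB = {}" unfolding drawn_def by blast
    have "e \<inter> A = {u}" "e \<inter> B = {v}" using e uv AB by auto
    then show "path_image (\<gamma> e) \<inter> drawn A FA = {p u}" "path_image (\<gamma> e) \<inter> drawn B FB = {p v}"
      using edge_Int_drawn[OF e(1) sub(1,3) AB(1)] edge_Int_drawn[OF e(1) sub(2,4) AB(2)]
      by (auto simp: FA_def FB_def)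
  qed
qed

text \<open>An edge on a cycle has at most one face on each side of the closed curve drawn by that cycle, and
  a bridge has the same face on both sides.\<close>

lemma edge_borders_two_faces:
  assumes F: "F \<subseteq> E" and e: "e \<in> F"
  shows "finite {C \<in> faces F. e \<in> boundary_edges F C} \<and> card {C \<in> faces F. e \<in> boundary_edges F C} \<le> 2"
proof (rule card_le_2I)
  fix C1 C2 C3
  assume C: "C1 \<in> {C \<in> faces F. e \<in> boundary_edges F C}" "C2 \<in> {C \<in> faces F. e \<in> boundary_edges F C}"
    "C3 \<in> {C \<in> faces F. e \<in> boundary_edges F C}"
  define K where "K = drawn V (F - {e})"
  have eE: "e \<in> E" using F e by blast
  have FE: "F - {e} \<subseteq> E" using F by blast
  have K: "compact K" unfolding K_def using F by (intro compact_drawn) auto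
  have gK: "path_image (\<gamma> e) \<inter> K = {pathstart (\<gamma> e), pathfinish (\<gamma> e)}"
    unfolding K_def using F eE by (intro edge_Int_drawn_V) auto
  have Ke: "K \<union> path_image (\<gamma> e) = drawn V F"
    unfolding K_def using drawn_insert[of V e "F - {e}"] e by (simp add: insert_absorb)
  have "path_image (\<gamma> e) - p ` V = path_image (\<gamma> e) - K"
    using gK edge_ends[OF eE] edge_verts[OF eE] by blast
  then have t: "C \<in> components (- (K \<union> path_image (\<gamma> e))) \<and> closure C \<inter> (path_image (\<gamma> e) - K) \<noteq> {}"
    if "C \<in> {C1, C2, C3}" for C
    using that C Ke unfolding boundary_edges_def by auto
  obtain u v where uv: "e = {u, v}" "u \<noteq> v" "u \<in> V" "v \<in> V"
    "pathstart (\<gamma> e) = p u" "pathfinish (\<gamma> e) = p v"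
    using obtain_ends[OF eE] .
  show "C1 = C2 \<or> C1 = C3 \<or> C2 = C3"
  proof (cases "joined (F - {e}) u v")
    case True
    then obtain q where q: "arc q" "path_image q \<subseteq> K" "pathstart q = p u" "pathfinish q = p v"
      using joined_arc[OF FE True] uv unfolding K_def by blast
    show ?thesis
    proof (rule chord_two_sides[OF K arc_edge[OF eE] _ _ _ _ gK t])
      show "arc (reversepath q)" using q by (simp add: arc_reversepath)
      show "path_image (reversepath q) \<subseteq> K" using q by simp
      show "pathstart (reversepath q) = pathfinish (\<gamma> e)" "pathfinish (reversepath q) = pathstart (\<gamma> e)"
        using q uv by simp_all
    qed
  next
    case False
    then obtain K1 K2 where K12: "compact K1" "compact K2" "K1 \<inter> K2 = {}" "K1 \<union> K2 = K"
      "path_image (\<gamma> e) \<inter> K1 = {p u}" "path_image (\<gamma> e) \<inter> K2 = {p v}"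
      using unjoined_split[OF FE eE _ uv(1) False] unfolding K_def by blast
    obtain y1 y2 where y: "y1 \<in> C1" "y2 \<in> C2" using C in_components_nonempty by blast
    have "connected_component (- K) y1 y2"
      using t[of C1] t[of C2] touching_components_joined[OF arc_edge[OF eE] gK _ _ _ _ y] by blast
    moreover have "y1 \<notin> path_image (\<gamma> e)" "y2 \<notin> path_image (\<gamma> e)"
      using t y in_components_subset by blast+
    ultimately have "connected_component (- (K \<union> path_image (\<gamma> e))) y1 y2"
      using bridge_keeps_connected[OF arc_edge[OF eE] K12(1,2,5,6,3)] K12(4) by simp
    then have "C1 = C2" using components_eq_if_connected t y by (metis insertCI)
    then show ?thesis ..
  qed
qed

lemma connected_compl_verts: "connected (- drawn V {})"
  using fin_V unfolding drawn_def
  by (auto intro!: path_connected_imp_connected path_connected_complement_countable countable_finite)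

text \<open>A forest is built by adding bridges, which never disconnect the complement.\<close>

lemma acyclic_connected_compl:
  assumes "F \<subseteq> E" "\<nexists>xs. graph_cycle \<lparr>verts = V, edges = F\<rparr> xs"
  shows "connected (- drawn V F)"
proof -
  have "finite F" using assms fin_E finite_subset by blast
  then show ?thesis using assms
  proof (induction F rule: finite_induct)
    case empty
    show ?case by (rule connected_compl_verts)
  next
    case (insert e F)
    have e: "e \<in> E" "F \<subseteq> E" using insert.prems by auto
    have "\<nexists>xs. graph_cycle \<lparr>verts = V, edges = F\<rparr> xs"
      using insert.prems(2) graph_cycle_mono[of V F _ "\<lparr>verts = V, edges = insert e F\<rparr>"] by auto
    then have conn: "connected (- drawn V F)" using insert.IH e by blast
    obtain u v where uv: "e = {u, v}" "u \<noteq> v" "u \<in> V" "v \<in> V"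
      "pathstart (\<gamma> e) = p u" "pathfinish (\<gamma> e) = p v"
      using obtain_ends[OF e(1)] .
    have nj: "\<not> joined F u v"
    proof
      assume j: "joined F u v"
      have "{u, v} \<notin> F" using insert.hyps(2) uv(1) by simp
      moreover have "f \<subseteq> V" if "f \<in> F" for f using that e(2) edgeD by blast
      ultimately show False
        using joined_closes_cycle[OF j uv(3,2)] insert.prems(2) uv(1) by simp
    qed
    obtain K1 K2 where K: "compact K1" "compact K2" "K1 \<inter> K2 = {}" "K1 \<union> K2 = drawn V F"
      "path_image (\<gamma> e) \<inter> K1 = {p u}" "path_image (\<gamma> e) \<inter> K2 = {p v}"
      using unjoined_split[OF e(2) e(1) insert.hyps(2) uv(1) nj] .
    show ?case unfolding connected_iff_connected_component
    proof (intro ballI)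
      fix y z assume yz: "y \<in> - drawn V (insert e F)" "z \<in> - drawn V (insert e F)"
      then have "connected_component (- (K1 \<union> K2)) y z" "y \<notin> path_image (\<gamma> e)" "z \<notin> path_image (\<gamma> e)"
        using conn K(4) unfolding drawn_insert connected_iff_connected_component by auto
      then have "connected_component (- (K1 \<union> K2 \<union> path_image (\<gamma> e))) y z"
        using bridge_keeps_connected[OF arc_edge[OF e(1)] K(1,2,5,6,3)] by blast
      then show "connected_component (- drawn V (insert e F)) y z"
        using K(4) unfolding drawn_insert by simp
    qed
  qed
qed

text \<open>The frontier of \<open>C\<close> is drawn by its boundary edges. If these form a forest, their complement is
  connected, so \<open>C\<close>, which has no frontier in it, fills it completely; an edge elsewhere would then
  run inside \<open>C\<close>.\<close>

lemma acyclic_boundary_only_face: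
  assumes F: "F \<subseteq> E" and C: "C \<in> faces F"
    and nc: "\<nexists>xs. graph_cycle \<lparr>verts = V, edges = boundary_edges F C\<rparr> xs"
  shows "boundary_edges F C = F" "C = - drawn V F"
proof -
  have sub: "boundary_edges F C \<subseteq> F" by (auto simp: boundary_edges_def)
  have conn: "connected (- drawn V (boundary_edges F C))"
    using acyclic_connected_compl[OF _ nc] sub F by blast
  have fr: "frontier C \<subseteq> drawn V F"
    using frontier_of_components_closed_complement[OF _ C] compact_imp_closed[OF compact_drawn] F by blast
  have "frontier C \<subseteq> drawn V (boundary_edges F C)"
  proof
    fix x assume x: "x \<in> frontier C"
    then have "x \<in> closure C" "x \<in> drawn V F" using fr frontier_def by auto
    then show "x \<in> drawn V (boundary_edges F C)" unfolding drawn_def boundary_edges_def by blast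
  qed
  moreover have CF: "C \<subseteq> - drawn V F" "C \<noteq> {}"
    using C in_components_subset in_components_nonempty by blast+
  moreover have "drawn V (boundary_edges F C) \<subseteq> drawn V F" using sub unfolding drawn_def by blast
  ultimately have Ceq: "C = - drawn V (boundary_edges F C)"
    using connected_Int_frontier[OF conn, of C] by blast
  show "boundary_edges F C = F"
  proof (rule ccontr)
    assume "boundary_edges F C \<noteq> F"
    then obtain e where e: "e \<in> F" "e \<notin> boundary_edges F C" using sub by blast
    then have "path_image (\<gamma> e) \<inter> drawn V (boundary_edges F C) = {pathstart (\<gamma> e), pathfinish (\<gamma> e)}"
      using F sub by (intro edge_Int_drawn_V) auto
    then have "\<gamma> e (1/2) \<in> C"
      using arc_midpoint_not_end[OF arc_edge] e F Ceq by blast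
    moreover have "\<gamma> e (1/2) \<in> drawn V F"
      using arc_midpoint_not_end[OF arc_edge] e F unfolding drawn_def by blast
    ultimately show False using CF by blast
  qed
  then show "C = - drawn V F" using Ceq by simp
qed

lemma finite_faces:
  assumes F: "F \<subseteq> E"
  shows "finite (faces F)"
proof (cases "F = {}")
  case True
  then show ?thesis
    using components_connected_subset[OF connected_compl_verts] by (simp add: finite_subset)
next
  case False
  have "faces F \<subseteq> (\<Union>e\<in>F. {C \<in> faces F. e \<in> boundary_edges F C})"
  proof
    fix C assume C: "C \<in> faces F"
    have "boundary_edges F C \<noteq> {}"
    proof
      assume b: "boundary_edges F C = {}"
      have "\<nexists>xs. graph_cycle \<lparr>verts = V, edges = {}\<rparr> xs" by (auto simp: graph_cycle_def)
      then show False using acyclic_boundary_only_face(1)[OF F C] b False by simp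
    qed
    then show "C \<in> (\<Union>e\<in>F. {C \<in> faces F. e \<in> boundary_edges F C})" using C by (auto simp: boundary_edges_def)
  qed
  moreover have "finite (\<Union>e\<in>F. {C \<in> faces F. e \<in> boundary_edges F C})"
    using edge_borders_two_faces[OF F] finite_subset[OF F fin_E] by (intro finite_UN_I) blast+
  ultimately show ?thesis by (rule finite_subset)
qed

text \<open>Removing edges that are not bridges loses at least one face each time and ends in a forest, where
  \<open>forest_card\<close> and the existence of one face suffice.\<close>

lemma euler_inequality:
  assumes "F \<subseteq> E" and V: "V \<noteq> {}"
  shows "card F + 2 \<le> card (faces F) + card V"
proof -
  have "finite F" using assms fin_E finite_subset by blast
  then show ?thesis using assms(1)
  proof (induction "card F" arbitrary: F rule: less_induct)
    case less
    show ?case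
    proof (cases "\<exists>u v. {u, v} \<in> F \<and> joined (F - {{u, v}}) u v")
      case True
      then obtain e where e: "e \<in> F" "\<exists>u v. e = {u, v} \<and> joined (F - {e}) u v" by blast
      then have eE: "e \<in> E" "F - {e} \<subseteq> E" using less.prems by auto
      obtain u v where uv: "e = {u, v}" "u \<noteq> v" "u \<in> V" "v \<in> V"
        "pathstart (\<gamma> e) = p u" "pathfinish (\<gamma> e) = p v"
        using obtain_ends[OF eE(1)] .
      define K where "K = drawn V (F - {e})"
      obtain a b where ab: "e = {a, b}" "joined (F - {e}) a b" using e by blast
      have "a = u \<and> b = v \<or> a = v \<and> b = u" using ab(1) uv(1) by (auto simp: doubleton_eq_iff)
      then have j: "joined (F - {e}) v u \<or> joined (F - {e}) u v" using ab(2) by blast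
      obtain q where q: "arc q" "path_image q \<subseteq> K" "pathstart q = p v" "pathfinish q = p u"
        using j
      proof
        assume "joined (F - {e}) v u"
        then show thesis using joined_arc[OF eE(2), of v u] uv that unfolding K_def by blast
      next
        assume "joined (F - {e}) u v"
        then obtain q where "arc q" "path_image q \<subseteq> K" "pathstart q = p u" "pathfinish q = p v"
          using joined_arc[OF eE(2), of u v] uv unfolding K_def by blast
        then show thesis using that[of "reversepath q"] by (simp add: arc_reversepath)
      qed
      have K: "compact K" unfolding K_def using eE by (intro compact_drawn) auto
      have Ke: "K \<union> path_image (\<gamma> e) = drawn V F"
        unfolding K_def using drawn_insert[of V e "F - {e}"] e by (simp add: insert_absorb)
      have gK: "path_image (\<gamma> e) \<inter> K = {pathstart (\<gamma> e), pathfinish (\<gamma> e)}"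
        unfolding K_def using eE by (intro edge_Int_drawn_V) auto
      obtain y z where "connected_component (- K) y z" "y \<notin> path_image (\<gamma> e)" "z \<notin> path_image (\<gamma> e)"
        "\<not> connected_component (- (K \<union> path_image (\<gamma> e))) y z"
        using chord_splits_complement[OF K arc_edge[OF eE(1)] q(1,2) _ _ gK] q uv by metis
      then have "card (components (- K)) < card (components (- (K \<union> path_image (\<gamma> e))))"
        using finite_faces[OF less.prems(2)] Ke K arc_edge[OF eE(1)]
        by (intro card_components_increases compact_imp_closed interior_arc_image_empty) auto
      then have "card (faces (F - {e})) < card (faces F)" using Ke unfolding K_def by simp
      moreover have "card (F - {e}) + 2 \<le> card (faces (F - {e})) + card V"
        using less.hyps[of "F - {e}"] e less.prems eE by (meson card_Diff1_less finite_Diff)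
      moreover have "card F = card (F - {e}) + 1" using e less.prems(1)
        by (metis Suc_eq_plus1 card.remove)
      ultimately show ?thesis by simp
    next
      case False
      then have "card F + 1 \<le> card V"
        using forest_card[of V F] fin_V V edgeD less.prems by blast
      moreover have "- drawn V F \<noteq> {}"
        using compact_drawn[OF subset_refl less.prems(2)] not_compact_UNIV by (metis Compl_empty_eq double_complement)
      then have "card (faces F) \<noteq> 0" using finite_faces[OF less.prems(2)] components_eq_empty by auto
      ultimately show ?thesis by simp
    qed
  qed
qed

text \<open>With \<open>f\<close> faces, each bordered by a cycle and hence by at least \<open>g\<close> edges, and each edge
  bordering at most two faces, \<open>g f \<le> 2 m\<close>; insert this into \<open>m + 2 \<le> f + n\<close>. If some face is not
  bordered by a cycle it is the only one, and \<open>m + 1 \<le> n\<close>.\<close>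

theorem edge_bound_by_girth:
  assumes V: "V \<noteq> {}" and g: "\<And>xs. graph_cycle \<lparr>verts = V, edges = E\<rparr> xs \<Longrightarrow> g \<le> length xs"
  shows "g * (card E + 1) \<le> g * card V + 2 * card E"
proof (cases "\<exists>C \<in> faces E. \<nexists>xs. graph_cycle \<lparr>verts = V, edges = boundary_edges E C\<rparr> xs")
  case True
  then obtain C where C: "C \<in> faces E" "\<nexists>xs. graph_cycle \<lparr>verts = V, edges = boundary_edges E C\<rparr> xs" by blast
  have "C = - drawn V E" using acyclic_boundary_only_face(2)[OF _ C] by blast
  then have "connected (- drawn V E)" using C in_components_connected by metis
  then have "card (faces E) \<le> card {- drawn V E}"
    by (intro card_mono components_connected_subset) simp
  then have "card E + 1 \<le> card V" using euler_inequality[OF subset_refl V] by simp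
  then have "g * (card E + 1) \<le> g * card V" by (rule mult_le_mono2)
  then show ?thesis by simp
next
  case False
  have b: "g \<le> card (boundary_edges E C)" if C: "C \<in> faces E" for C
  proof -
    obtain xs where xs: "graph_cycle \<lparr>verts = V, edges = boundary_edges E C\<rparr> xs" using False C by blast
    have sub: "boundary_edges E C \<subseteq> E" by (auto simp: boundary_edges_def)
    have "g \<le> length xs"
      using g graph_cycle_mono[OF xs, of "\<lparr>verts = V, edges = E\<rparr>"] sub by simp
    also have "length xs \<le> card (boundary_edges E C)"
      using graph_cycle_length_le[OF xs] sub fin_E finite_subset by blast
    finally show ?thesis .
  qed
  have "g * card (faces E) \<le> (\<Sum>C\<in>faces E. card (boundary_edges E C))"
    using sum_bounded_below[of "faces E" g "\<lambda>C. card (boundary_edges E C)"] b by (simp add: mult.commute)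
  also have "\<dots> = (\<Sum>C\<in>faces E. \<Sum>e\<in>E. if e \<in> boundary_edges E C then 1 else 0)"
    using fin_E by (intro sum.cong refl) (simp add: boundary_edges_def flip: sum.inter_filter)
  also have "\<dots> = (\<Sum>e\<in>E. \<Sum>C\<in>faces E. if e \<in> boundary_edges E C then 1 else 0)"
    by (rule sum.swap)
  also have "\<dots> = (\<Sum>e\<in>E. card {C \<in> faces E. e \<in> boundary_edges E C})"
    using finite_faces[OF subset_refl] by (intro sum.cong refl) (simp flip: sum.inter_filter)
  also have "\<dots> \<le> (\<Sum>e\<in>E. 2)"
    using edge_borders_two_faces by (intro sum_mono) blast
  finally have "g * card (faces E) \<le> 2 * card E" by simp
  moreover have "g * (card E + 2) \<le> g * (card (faces E) + card V)"
    using euler_inequality[OF subset_refl V] by (rule mult_le_mono2)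
  ultimately show ?thesis by (simp add: algebra_simps)
qed

end

section \<open>Prescribing inner products of bit vectors\<close>

instance bit :: finite
proof
  have "(UNIV :: bit set) = {0, 1}" by auto
  then show "finite (UNIV :: bit set)" by (metis finite.emptyI finite.insertI)
qed

lemma CARD_bit: "CARD(bit) = 2"
proof -
  have "(UNIV :: bit set) = {0, 1}" by auto
  then show ?thesis by (metis card_2_iff zero_neq_one)
qed

definition dot :: "bit ^ 'n \<Rightarrow> bit ^ 'n \<Rightarrow> bit" where
  "dot x y = (\<Sum>i\<in>UNIV. x $ i * y $ i)"

lemma dot_commute: "dot x y = dot y x"
  unfolding dot_def by (intro sum.cong refl) (rule mult.commute)

lemma dot_add: "dot (x + y) z = dot x z + dot y z"
  by (simp only: dot_def vector_add_component distrib_right sum.distrib)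

lemma dot_add_right: "dot z (x + y) = dot z x + dot z y"
  by (simp only: dot_def vector_add_component distrib_left sum.distrib)

lemma dot_zero: "dot 0 y = 0"
  by (simp add: dot_def)

lemma dot_sum: "dot (sum x S) y = (\<Sum>a\<in>S. dot (x a) y)"
  by (induction S rule: infinite_finite_induct) (simp_all add: dot_add dot_zero)

text \<open>The nontrivial character of the additive group of bits.\<close>

definition bit_sign :: "bit \<Rightarrow> int" where
  "bit_sign b = (if b = 0 then 1 else -1)"

lemma bit_sign_add: "bit_sign (a + b) = bit_sign a * bit_sign b"
  by (cases a; cases b) (auto simp: bit_sign_def)

lemma bit_sign_add_one: "bit_sign (a + b) + 1 = (if a = b then 2 else 0)"
  by (cases a; cases b) (auto simp: bit_sign_def)

lemma bit_sign_sum: "bit_sign (sum c S) = (\<Prod>a\<in>S. bit_sign (c a))"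
  by (induction S rule: infinite_finite_induct) (auto simp: bit_sign_add, auto simp: bit_sign_def)

text \<open>Flipping a coordinate where \<open>v\<close> is \<open>1\<close> permutes the vectors and changes every sign.\<close>

lemma sum_bit_sign_dot:
  fixes v :: "bit ^ 'n"
  assumes "v \<noteq> 0"
  shows "(\<Sum>y\<in>UNIV. bit_sign (dot v y)) = 0"
proof -
  obtain i where i: "v $ i = 1" using assms by (metis bit_not_zero_iff vec_eq_iff zero_index)
  have flip: "bit_sign (dot v (y + axis i 1)) = - bit_sign (dot v y)" for y
  proof -
    have "dot v (axis i 1) = 1"
    proof -
      have "dot v (axis i 1) = (\<Sum>j\<in>UNIV. if j = i then 1 else 0)"
        unfolding dot_def axis_def by (intro sum.cong refl) (use i in auto)
      then show ?thesis by simp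
    qed
    then show ?thesis by (simp add: dot_add_right bit_sign_add) (simp add: bit_sign_def)
  qed
  have "bij (\<lambda>y. y + axis i 1 :: bit ^ 'n)"
    by (rule bij_betw_byWitness[where f' = "\<lambda>y. y - axis i 1"]) auto
  then have "(\<Sum>y\<in>UNIV. bit_sign (dot v y)) = (\<Sum>y\<in>UNIV. bit_sign (dot v (y + axis i 1)))"
    by (rule sum.reindex_bij_betw[symmetric])
  then show ?thesis unfolding flip by (simp add: sum_negf)
qed

text \<open>Linear independence over the field of two elements of \<open>x\<close> as a family: a repeated vector counts
  as dependent, since two equal vectors have sum \<open>0\<close>.\<close>

definition indep :: "('a \<Rightarrow> bit ^ 'n) \<Rightarrow> 'a set \<Rightarrow> bool" where
  "indep x A \<longleftrightarrow> (\<forall>S\<subseteq>A. S \<noteq> {} \<longrightarrow> sum x S \<noteq> 0)"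

lemma indep_cong: "(\<And>a. a \<in> A \<Longrightarrow> x a = y a) \<Longrightarrow> indep x A \<Longrightarrow> indep y A"
  unfolding indep_def by (metis (no_types, lifting) subsetD sum.cong)

text \<open>Character sums count the solutions without any dimension theory. The product over \<open>a \<in> A\<close> of
  \<open>1 + bit_sign (x a \<bullet> y + c a)\<close> is \<open>2 ^ card A\<close> if \<open>y\<close> is a solution and \<open>0\<close> otherwise. Expanding it and summing
  over \<open>y\<close>, the term of a nonempty \<open>S \<subseteq> A\<close> is a multiple of the sum of the character of
  \<open>sum x S \<noteq> 0\<close> and vanishes, which leaves the number of all vectors.\<close>

lemma card_solutions:
  fixes x :: "'a \<Rightarrow> bit ^ 'n"
  assumes A: "finite A" and ind: "indep x A"
  shows "card {y. \<forall>a\<in>A. dot (x a) y = c a} * 2 ^ card A = 2 ^ CARD('n)"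
proof -
  let ?sol = "{y. \<forall>a\<in>A. dot (x a) y = c a}"
  let ?P = "\<lambda>y. \<Prod>a\<in>A. bit_sign (dot (x a) y + c a) + 1"
  have P: "?P y = (if y \<in> ?sol then 2 ^ card A else 0)" for y
  proof (cases "y \<in> ?sol")
    case True
    then have "?P y = (\<Prod>a\<in>A. 2)" unfolding bit_sign_add_one by (intro prod.cong) auto
    then show ?thesis using True by (simp only: prod_constant if_True)
  next
    case False
    then obtain a where a: "a \<in> A" "dot (x a) y \<noteq> c a" by blast
    then have "?P y = 0" unfolding bit_sign_add_one using A by (intro prod_zero) auto
    then show ?thesis using False by (simp only: if_False)
  qed
  have expand: "?P y = (\<Sum>S\<in>Pow A. bit_sign (sum c S) * bit_sign (dot (sum x S) y))" for y
    unfolding prod_add[OF A]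
    by (intro sum.cong refl) (simp only: dot_sum bit_sign_sum bit_sign_add prod.distrib prod.neutral_const mult.right_neutral mult.commute)
  have "int (card ?sol) * 2 ^ card A = (\<Sum>y\<in>UNIV. ?P y)"
    unfolding P by (simp add: sum.If_cases)
  also have "\<dots> = (\<Sum>S\<in>Pow A. bit_sign (sum c S) * (\<Sum>y\<in>UNIV. bit_sign (dot (sum x S) y)))"
    unfolding expand by (subst sum.swap) (simp add: sum_distrib_left)
  also have "\<dots> = (\<Sum>S\<in>Pow A. if S = {} then 2 ^ CARD('n) else 0)"
  proof (intro sum.cong refl)
    fix S assume S: "S \<in> Pow A"
    show "bit_sign (sum c S) * (\<Sum>y\<in>UNIV. bit_sign (dot (sum x S) y)) = (if S = {} then 2 ^ CARD('n) else 0)"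
    proof (cases "S = {}")
      case True
      then show ?thesis by (simp add: dot_zero bit_sign_def CARD_bit)
    next
      case False
      then have "sum x S \<noteq> 0" using ind S unfolding indep_def by blast
      then have "(\<Sum>y\<in>UNIV. bit_sign (dot (sum x S) y)) = 0" by (rule sum_bit_sign_dot)
      then show ?thesis using False by simp
    qed
  qed
  also have "\<dots> = 2 ^ CARD('n)" using A by (simp add: sum.delta)
  finally have "int (card ?sol * 2 ^ card A) = int (2 ^ CARD('n))" by simp
  then show ?thesis by (simp only: of_nat_eq_iff)
qed

lemma vec_bit_add_self: "(y :: bit ^ 'n) + y = 0"
  by (simp add: vec_eq_iff)

lemma indep_insert:
  assumes A: "finite A" "v \<notin> A" and ind: "indep x A" and y: "\<And>S. S \<subseteq> A \<Longrightarrow> y \<noteq> sum x S"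
  shows "indep (x(v := y)) (insert v A)"
  unfolding indep_def
proof (intro allI impI)
  fix S assume S: "S \<subseteq> insert v A" "S \<noteq> {}"
  let ?x = "x(v := y)"
  have same: "sum ?x (S - {v}) = sum x (S - {v})" by (rule sum.cong) auto
  show "sum ?x S \<noteq> 0"
  proof (cases "v \<in> S")
    case True
    have "finite S" using S A finite_subset by blast
    then have "sum ?x S = y + sum x (S - {v})" using True same by (simp add: sum.remove)
    moreover have "y \<noteq> sum x (S - {v})" using S by (intro y) blast
    ultimately show ?thesis using vec_bit_add_self by (metis add_left_imp_eq add.commute)
  next
    case False
    then show ?thesis using S ind same unfolding indep_def by (metis Diff_empty Diff_insert0 subset_insert)
  qed
qed

section \<open>Choosing the vectors greedily\<close>

definition nbhd :: "'a set set \<Rightarrow> 'a \<Rightarrow> 'a set" where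
  "nbhd E v = {u. {u, v} \<in> E}"

text \<open>The index sets of the sums that the vector of \<open>v\<close> has to avoid when \<open>v\<close> is the last vertex of
  \<open>U\<close> to be treated. Index sets are collected rather than sums, because they must be counted
  before any vector is known.\<close>

definition forbidden :: "'a set set \<Rightarrow> 'a set \<Rightarrow> 'a \<Rightarrow> 'a set set" where
  "forbidden E U v = (\<Union>w\<in>nbhd E v - U. Pow (nbhd E w \<inter> U - {v}))"

lemma in_nbhd_sym: "u \<in> nbhd E v \<longleftrightarrow> v \<in> nbhd E u"
  by (simp add: nbhd_def insert_commute)

text \<open>Induction on \<open>U\<close>, with independence of the vectors seen by each vertex outside \<open>U\<close> as part of the
  claim: it makes the system of equations for the next vertex solvable in the expected number of
  ways. The bound \<open>k\<close> on what outside vertices see is handed down from \<open>U\<close> to \<open>U - {v}\<close>, since the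
  vertex \<open>v\<close> given by the hypothesis obeys it too.\<close>

lemma greedy_vectors:
  fixes \<pi> :: "'a set \<Rightarrow> bit"
  assumes V: "finite V" "\<And>e. e \<in> E \<Longrightarrow> e \<subseteq> V \<and> card e = 2"
    and step: "\<And>U. \<lbrakk>U \<subseteq> V; U \<noteq> {}; \<And>w. w \<in> V - U \<Longrightarrow> card (nbhd E w \<inter> U) \<le> k\<rbrakk> \<Longrightarrow>
      \<exists>v\<in>U. card (nbhd E v \<inter> U) \<le> k \<and> card (forbidden E U v) * 2 ^ card (nbhd E v \<inter> U) < 2 ^ CARD('n)"
  shows "\<exists>x :: 'a \<Rightarrow> bit ^ 'n. \<forall>u v. {u, v} \<in> E \<longrightarrow> dot (x u) (x v) = \<pi> {u, v}"
proof -
  have irrefl: "v \<notin> nbhd E v" for v using V(2)[of "{v}"] by (auto simp: nbhd_def)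
  have "\<exists>x :: 'a \<Rightarrow> bit ^ 'n. (\<forall>u\<in>U. \<forall>v\<in>U. {u, v} \<in> E \<longrightarrow> dot (x u) (x v) = \<pi> {u, v}) \<and>
      (\<forall>w\<in>V - U. indep x (nbhd E w \<inter> U))"
    if "U \<subseteq> V" "\<And>w. w \<in> V - U \<Longrightarrow> card (nbhd E w \<inter> U) \<le> k" for U
    using finite_subset[OF that(1) V(1)] that
  proof (induction "card U" arbitrary: U rule: less_induct)
    case less
    show ?case
    proof (cases "U = {}")
      case True
      then show ?thesis by (auto simp: indep_def)
    next
      case False
      then obtain v where v: "v \<in> U" "card (nbhd E v \<inter> U) \<le> k"
        "card (forbidden E U v) * 2 ^ card (nbhd E v \<inter> U) < 2 ^ CARD('n)"
        using step less.prems by blast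
      define U' where "U' = U - {v}"
      have U': "U' \<subseteq> V" "finite U'" "U = insert v U'" "v \<notin> U'"
        using less.prems v by (auto simp: U'_def)
      have Nv: "nbhd E v \<inter> U' = nbhd E v \<inter> U" using irrefl by (auto simp: U'_def)
      have small: "card (nbhd E w \<inter> U') \<le> k" if w: "w \<in> V - U'" for w
      proof (cases "w = v")
        case True
        then show ?thesis using v Nv by simp
      next
        case False
        then have "w \<in> V - U" using w U' by blast
        then have "card (nbhd E w \<inter> U) \<le> k" by (rule less.prems(3))
        moreover have "card (nbhd E w \<inter> U') \<le> card (nbhd E w \<inter> U)"
          using less.prems(1) U' by (intro card_mono) auto
        ultimately show ?thesis by simp
      qed
      have "card U' < card U" using U' less.prems(1) by simp
      then obtain x :: "'a \<Rightarrow> bit ^ 'n"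
        where x: "\<And>a b. \<lbrakk>a \<in> U'; b \<in> U'; {a, b} \<in> E\<rbrakk> \<Longrightarrow> dot (x a) (x b) = \<pi> {a, b}"
        and xi: "\<And>w. w \<in> V - U' \<Longrightarrow> indep x (nbhd E w \<inter> U')"
        using less.hyps[of U'] U' small by blast
      let ?sol = "{y. \<forall>a\<in>nbhd E v \<inter> U'. dot (x a) y = \<pi> {a, v}}"
      have finN: "finite (nbhd E v \<inter> U')" using U'(2) by simp
      have finF: "finite (forbidden E U v)"
      proof (rule finite_subset)
        show "forbidden E U v \<subseteq> Pow U" unfolding forbidden_def by blast
      qed (use less.prems(1) in simp)
      have "indep x (nbhd E v \<inter> U')" using xi[of v] v(1) less.prems(2) U'(4) by blast
      then have "card ?sol * 2 ^ card (nbhd E v \<inter> U') = 2 ^ CARD('n)"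
        by (rule card_solutions[OF finN])
      then have "card (forbidden E U v) * 2 ^ card (nbhd E v \<inter> U) < card ?sol * 2 ^ card (nbhd E v \<inter> U)"
        using v(3) unfolding Nv by simp
      then have "card (forbidden E U v) < card ?sol" by simp
      then have "card (sum x ` forbidden E U v) < card ?sol"
        using card_image_le[OF finF, of "sum x"] by simp
      then have "\<not> ?sol \<subseteq> sum x ` forbidden E U v"
        using card_mono[of "sum x ` forbidden E U v" ?sol] finF by auto
      then obtain y where y: "\<And>a. a \<in> nbhd E v \<inter> U' \<Longrightarrow> dot (x a) y = \<pi> {a, v}"
        and yn: "y \<notin> sum x ` forbidden E U v" by blast
      show ?thesis
      proof (intro exI[of _ "x(v := y)"] conjI ballI impI)
        fix a b assume ab: "a \<in> U" "b \<in> U" "{a, b} \<in> E"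
        have "a \<noteq> b" using ab(3) irrefl[of a] by (auto simp: nbhd_def)
        then consider "a \<in> U'" "b \<in> U'" | "a = v" "b \<in> U'" | "b = v" "a \<in> U'"
          using ab U' by auto
        then show "dot ((x(v := y)) a) ((x(v := y)) b) = \<pi> {a, b}"
        proof cases
          case 1
          then show ?thesis using x[of a b] ab U' by auto
        next
          case 2
          then have "dot (x b) y = \<pi> {b, v}" using y[of b] ab by (simp add: nbhd_def insert_commute)
          then show ?thesis using 2 U' by (auto simp: dot_commute insert_commute)
        next
          case 3
          then have "dot (x a) y = \<pi> {a, v}" using y[of a] ab by (simp add: nbhd_def)
          then show ?thesis using 3 U' by auto
        qed
      next
        fix w assume w: "w \<in> V - U"
        have wi: "indep x (nbhd E w \<inter> U')" using xi[of w] w U'(3) by blast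
        show "indep (x(v := y)) (nbhd E w \<inter> U)"
        proof (cases "v \<in> nbhd E w")
          case True
          have "nbhd E w \<inter> U = insert v (nbhd E w \<inter> U')" using True U' by blast
          moreover have "indep (x(v := y)) (insert v (nbhd E w \<inter> U'))"
          proof (rule indep_insert[OF _ _ wi])
            fix S assume "S \<subseteq> nbhd E w \<inter> U'"
            then have "S \<in> forbidden E U v"
              using True w in_nbhd_sym[of v E w] unfolding forbidden_def U'_def by blast
            then show "y \<noteq> sum x S" using yn by blast
          qed (use U' in auto)
          ultimately show ?thesis by simp
        next
          case False
          then have eq: "nbhd E w \<inter> U = nbhd E w \<inter> U'" using U'(3) by blast
          show ?thesis unfolding eq by (rule indep_cong[OF _ wi]) (use U'(4) in auto)
        qed
      qed
    qed
  qed
  from this[of V] obtain x :: "'a \<Rightarrow> bit ^ 'n"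
    where x: "\<And>u v. \<lbrakk>u \<in> V; v \<in> V; {u, v} \<in> E\<rbrakk> \<Longrightarrow> dot (x u) (x v) = \<pi> {u, v}" by blast
  show ?thesis using x V(2) by (intro exI[of _ x]) blast
qed

section \<open>A vertex with few constraints in a triangle-free plane graph\<close>

lemma sum_nbhd_eq:
  assumes U: "finite U" and E: "\<And>e. e \<in> E \<Longrightarrow> card e = 2"
  shows "(\<Sum>v\<in>U. card (nbhd E v \<inter> U)) = 2 * card {e \<in> E. e \<subseteq> U}"
proof -
  let ?F = "{e \<in> E. e \<subseteq> U}"
  have F: "finite ?F" using U by (intro finite_subset[of ?F "Pow U"]) auto
  have "card (nbhd E v \<inter> U) = card {e \<in> ?F. v \<in> e}" if v: "v \<in> U" for v
  proof (rule bij_betw_same_card)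
    show "bij_betw (\<lambda>u. {u, v}) (nbhd E v \<inter> U) {e \<in> ?F. v \<in> e}"
    proof (rule bij_betw_imageI)
      show "inj_on (\<lambda>u. {u, v}) (nbhd E v \<inter> U)" by (auto simp: inj_on_def doubleton_eq_iff)
      show "(\<lambda>u. {u, v}) ` (nbhd E v \<inter> U) = {e \<in> ?F. v \<in> e}"
      proof (intro equalityI subsetI)
        fix e assume e: "e \<in> {e \<in> ?F. v \<in> e}"
        then obtain u where "e = {u, v}" using E[of e] by (auto simp: card_2_iff)
        then show "e \<in> (\<lambda>u. {u, v}) ` (nbhd E v \<inter> U)" using e by (auto simp: nbhd_def)
      qed (use v in \<open>auto simp: nbhd_def\<close>)
    qed
  qed
  then have "(\<Sum>v\<in>U. card (nbhd E v \<inter> U)) = (\<Sum>v\<in>U. card {e \<in> ?F. v \<in> e})" by simp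
  also have "\<dots> = 2 * card ?F"
  proof (rule sum_multicount[OF U F])
    show "\<forall>e\<in>?F. card {v \<in> U. v \<in> e} = 2"
    proof
      fix e assume e: "e \<in> ?F"
      then have "{v \<in> U. v \<in> e} = e" by auto
      then show "card {v \<in> U. v \<in> e} = 2" using E e by simp
    qed
  qed
  finally show ?thesis .
qed

context plane_graph
begin

lemma subgraph:
  assumes "W \<subseteq> V" "F \<subseteq> E" "\<And>e. e \<in> F \<Longrightarrow> e \<subseteq> W"
  shows "plane_graph W F p \<gamma>"
proof
  have "finite W" using assms(1) fin_V by (rule finite_subset)
  moreover have "e \<subseteq> W \<and> card e = 2" if "e \<in> F" for e using that assms(2,3) edgeD by blast
  ultimately show "simple_graph \<lparr>verts = W, edges = F\<rparr>" by (simp add: simple_graph_def)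
  have "path_image (\<gamma> e) \<inter> p ` W = p ` e" if "e \<in> F" for e
    using edge_verts[of e] assms that by blast
  moreover have "inj_on p W" using inj_p assms(1) by (rule inj_on_subset)
  moreover have "arc (\<gamma> e) \<and> {pathstart (\<gamma> e), pathfinish (\<gamma> e)} = p ` e" if "e \<in> F" for e
    using arc_edge[of e] edge_ends[of e] assms(2) that by blast
  moreover have "path_image (\<gamma> e) \<inter> path_image (\<gamma> f) \<subseteq> p ` (e \<inter> f)"
    if "e \<in> F" "f \<in> F" "e \<noteq> f" for e f
    using edge_edge[of e f] assms(2) that by blast
  ultimately show "plane_drawing \<lparr>verts = W, edges = F\<rparr> p \<gamma>"
    unfolding plane_drawing_def by simp
qed

text \<open>The bound by girth \<open>4\<close> for the graph on \<open>U \<union> C\<close> with all edges that meet \<open>U\<close>; the first sum counts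
  the edges inside \<open>U\<close> twice.\<close>

lemma triangle_free_count:
  assumes g4: "\<And>xs. graph_cycle \<lparr>verts = V, edges = E\<rparr> xs \<Longrightarrow> 4 \<le> length xs"
    and U: "U \<subseteq> V" "U \<noteq> {}" and C: "C \<subseteq> V - U"
  shows "(\<Sum>v\<in>U. card (nbhd E v \<inter> U)) + 2 * (\<Sum>w\<in>C. card (nbhd E w \<inter> U)) + 4 \<le> 4 * card U + 4 * card C"
proof -
  have fin: "finite U" "finite C"
    using finite_subset[OF U(1) fin_V] finite_subset[OF C] fin_V by simp_all
  define F1 where "F1 = {e \<in> E. e \<subseteq> U}"
  define F2 where "F2 = (\<lambda>(w, u). {w, u}) ` Sigma C (\<lambda>w. nbhd E w \<inter> U)"
  have F1: "F1 \<subseteq> E" "\<And>e. e \<in> F1 \<Longrightarrow> e \<subseteq> U" by (auto simp: F1_def)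
  have F2: "F2 \<subseteq> E"
  proof
    fix e assume "e \<in> F2"
    then obtain w u where "e = {w, u}" "u \<in> nbhd E w" by (auto simp: F2_def)
    then show "e \<in> E" by (simp add: nbhd_def insert_commute)
  qed
  have F2': "e \<subseteq> U \<union> C" "\<not> e \<subseteq> U" if "e \<in> F2" for e using that C by (auto simp: F2_def)
  \<comment> \<open>No edge is counted from both ends, because \<open>C\<close> and \<open>U\<close> are disjoint.\<close>
  have "inj_on (\<lambda>(w, u). {w, u}) (Sigma C (\<lambda>w. nbhd E w \<inter> U))"
    using C by (force simp: inj_on_def doubleton_eq_iff)
  then have c2: "card F2 = (\<Sum>w\<in>C. card (nbhd E w \<inter> U))"
    unfolding F2_def using fin by (simp add: card_image)
  have c1: "(\<Sum>v\<in>U. card (nbhd E v \<inter> U)) = 2 * card F1"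
    unfolding F1_def by (rule sum_nbhd_eq) (use fin(1) edgeD in blast)+
  have "finite F1" "finite F2" 
    using finite_subset[OF F1(1) fin_E] finite_subset[OF F2 fin_E] by simp_all
  moreover have "F1 \<inter> F2 = {}" using F1(2) F2'(2) by blast
  ultimately have c: "card (F1 \<union> F2) = card F1 + card F2" by (rule card_Un_disjoint)
  have "U \<inter> C = {}" using C by blast
  then have cV: "card (U \<union> C) = card U + card C" by (rule card_Un_disjoint[OF fin])
  interpret H: plane_graph "U \<union> C" "F1 \<union> F2" p \<gamma>
  proof (rule subgraph)
    show "U \<union> C \<subseteq> V" using U(1) C by blast
    show "F1 \<union> F2 \<subseteq> E" using F1(1) F2 by blast
    show "e \<subseteq> U \<union> C" if "e \<in> F1 \<union> F2" for e using that F1(2)[of e] F2'(1)[of e] by blast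
  qed
  have "4 * (card (F1 \<union> F2) + 1) \<le> 4 * card (U \<union> C) + 2 * card (F1 \<union> F2)"
  proof (rule H.edge_bound_by_girth)
    fix xs assume "graph_cycle \<lparr>verts = U \<union> C, edges = F1 \<union> F2\<rparr> xs"
    then have "graph_cycle \<lparr>verts = V, edges = E\<rparr> xs"
    proof (rule graph_cycle_mono)
      show "U \<union> C \<subseteq> verts \<lparr>verts = V, edges = E\<rparr>" using U(1) C by auto
      show "F1 \<union> F2 \<subseteq> edges \<lparr>verts = V, edges = E\<rparr>" using F1(1) F2 by auto
    qed
    then show "4 \<le> length xs" by (rule g4)
  qed (use U(2) in simp)
  then show ?thesis unfolding c cV c1 using c2 by simp
qed

text \<open>A set, so that two vertices seeing the same pair count once: they impose the same condition.\<close>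

abbreviation pair_traces :: "'a set \<Rightarrow> 'a set set" where
  "pair_traces U \<equiv> {P. card P = 2 \<and> (\<exists>w\<in>V - U. nbhd E w \<inter> U = P)}"

text \<open>Choose one vertex for each pair. The bipartite graph joining the chosen vertices to their pairs
  has no cycle of length \<open>4\<close>, as two chosen vertices never see the same pair, so its girth is at
  least \<open>6\<close> and the bound by girth applies to a graph with \<open>card U + c\<close> vertices and \<open>2 c\<close> edges.\<close>

lemma pair_count:
  assumes U: "U \<subseteq> V" "U \<noteq> {}"
  shows "card (pair_traces U) \<le> 3 * card U"
proof -
  define Ps where "Ps = pair_traces U"
  have fin: "finite U" using U fin_V finite_subset by blast
  have PU: "P \<subseteq> U" "card P = 2" if "P \<in> Ps" for P using that unfolding Ps_def by auto
  have finP: "finite Ps" using PU(1) fin by (intro finite_subset[of Ps "Pow U"]) auto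
  have "\<exists>h. \<forall>P\<in>Ps. h P \<in> V - U \<and> nbhd E (h P) \<inter> U = P" 
    by (rule bchoice) (auto simp: Ps_def)
  then obtain h where h: "h P \<in> V - U" "nbhd E (h P) \<inter> U = P" if "P \<in> Ps" for P by blast
  have inj: "inj_on h Ps" by (rule inj_onI) (metis h(2))
  define F where "F = (\<lambda>(P, u). {h P, u}) ` Sigma Ps (\<lambda>P. P)"
  have F_iff: "{a, b} \<in> F \<longleftrightarrow> (\<exists>P\<in>Ps. (a = h P \<and> b \<in> P) \<or> (b = h P \<and> a \<in> P))" for a b
    unfolding F_def by (auto simp: doubleton_eq_iff)
  have sub: "F \<subseteq> E"
  proof
    fix e assume "e \<in> F"
    then obtain P u where "P \<in> Ps" "u \<in> P" "e = {h P, u}" by (auto simp: F_def)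
    then show "e \<in> E" using h(2)[of P] by (auto simp: nbhd_def insert_commute)
  qed
  have FU: "e \<subseteq> U \<union> h ` Ps" if "e \<in> F" for e using that PU unfolding F_def by blast
  have "inj_on (\<lambda>(P, u). {h P, u}) (Sigma Ps (\<lambda>P. P))"
  proof (rule inj_onI, clarify)
    fix P u Q v
    assume PQ: "{h P, u} = {h Q, v}" "u \<in> P" "v \<in> Q" and P: "P \<in> Ps" and Q: "Q \<in> Ps"
    have "h P \<notin> U" "h Q \<notin> U" "u \<in> U" "v \<in> U"
      using h(1)[OF P] h(1)[OF Q] PU(1)[OF P] PU(1)[OF Q] PQ by blast+
    then have "h P = h Q" "u = v" using PQ(1) by (auto simp: doubleton_eq_iff)
    then show "P = Q \<and> u = v" using inj P Q inj_onD by metis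
  qed
  moreover have "\<forall>P\<in>Ps. finite P" using PU(1) fin finite_subset by blast
  ultimately have "card F = (\<Sum>P\<in>Ps. card P)"
    unfolding F_def using finP by (simp add: card_image)
  then have cF: "card F = 2 * card Ps" using PU by simp
  have cV: "card (U \<union> h ` Ps) = card U + card Ps"
  proof -
    have "U \<inter> h ` Ps = {}" using h(1) by blast
    then show ?thesis using fin finP card_Un_disjoint[of U "h ` Ps"] card_image[OF inj] by simp
  qed
  have alt: "a \<in> U \<longleftrightarrow> b \<notin> U" if ab: "{a, b} \<in> F" for a b
  proof -
    obtain P where "P \<in> Ps" "a = h P \<and> b \<in> P \<or> b = h P \<and> a \<in> P" using ab unfolding F_iff by blast
    then show ?thesis using h(1)[of P] PU(1)[of P] by blast
  qed
  have two: "b = d"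
    if ac: "a \<in> U" "c \<in> U" "a \<noteq> c" and e: "{a, b} \<in> F" "{c, b} \<in> F" "{a, d} \<in> F" "{c, d} \<in> F" for a b c d
  proof -
    \<comment> \<open>The pair behind a common neighbour of \<open>a\<close> and \<open>c\<close> is forced to be \<open>{a, c}\<close>.\<close>
    have hub: "\<exists>P\<in>Ps. y = h P \<and> P = {a, c}" if y: "{a, y} \<in> F" "{c, y} \<in> F" for y
    proof -
      obtain P where P: "P \<in> Ps" "y = h P" "a \<in> P" using y(1) ac(1) h(1) unfolding F_iff by blast
      obtain Q where Q: "Q \<in> Ps" "y = h Q" "c \<in> Q" using y(2) ac(2) h(1) unfolding F_iff by blast
      have "P = Q" using inj P Q inj_onD by metis
      then have "{a, c} \<subseteq> P" "card {a, c} = card P" using P Q ac(3) PU(2)[OF P(1)] by auto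
      moreover have "finite P" using PU(1)[OF P(1)] fin by (rule finite_subset)
      ultimately have "P = {a, c}" using card_subset_eq by metis
      then show ?thesis using P by blast
    qed
    show ?thesis using hub[OF e(1,2)] hub[OF e(3,4)] by blast
  qed
  interpret H: plane_graph "U \<union> h ` Ps" F p \<gamma>
  proof (rule subgraph)
    show "U \<union> h ` Ps \<subseteq> V" using U(1) h(1) by blast
  qed (use sub FU in simp_all)
  have "6 * (card F + 1) \<le> 6 * card (U \<union> h ` Ps) + 2 * card F"
  proof (rule H.edge_bound_by_girth)
    fix xs assume cyc: "graph_cycle \<lparr>verts = U \<union> h ` Ps, edges = F\<rparr> xs"
    show "6 \<le> length xs"
    proof (rule ccontr)
      assume "\<not> 6 \<le> length xs"
      moreover have "3 \<le> length xs" using cyc by (simp add: graph_cycle_def)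
      ultimately have "length xs = 3 \<or> length xs = 4 \<or> length xs = 5" by linarith
      then consider (3) a b c where "xs = [a, b, c]" | (4) a b c d where "xs = [a, b, c, d]"
        | (5) a b c d e where "xs = [a, b, c, d, e]"
        by (auto simp: eval_nat_numeral length_Suc_conv)
      then show False
      proof cases
        case 3
        then have "{a, b} \<in> F" "{b, c} \<in> F" "{c, a} \<in> F"
          using cyc by (auto simp: graph_cycle_def walk_def)
        then show False using alt by blast
      next
        case 4
        then have e: "{a, b} \<in> F" "{b, c} \<in> F" "{c, d} \<in> F" "{d, a} \<in> F" and ne: "a \<noteq> c" "b \<noteq> d"
          using cyc by (auto simp: graph_cycle_def walk_def)
        show False
        proof (cases "a \<in> U")
          case True
          then have "c \<in> U" using alt e by blast
          then show False using two[of a c b d] True e ne by (simp add: insert_commute)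
        next
          case False
          then have "b \<in> U" "d \<in> U" using alt e by blast+
          then show False using two[of b d a c] e ne by (simp add: insert_commute)
        qed
      next
        case 5
        then have "{a, b} \<in> F" "{b, c} \<in> F" "{c, d} \<in> F" "{d, e} \<in> F" "{e, a} \<in> F"
          using cyc by (auto simp: graph_cycle_def walk_def)
        then show False using alt by blast
      qed
    qed
  qed (use U(2) in simp)
  then show ?thesis unfolding cF cV Ps_def[symmetric] by simp
qed

text \<open>The empty set is counted once. A nonempty forbidden set arising from \<open>w\<close> is a nonempty subset of
  the other neighbours of \<open>w\<close> in \<open>U\<close>; if \<open>w\<close> sees only two vertices of \<open>U\<close>, it is determined by the
  pair.\<close>

lemma card_forbidden_le:
  assumes U: "U \<subseteq> V" and v: "v \<in> U"
  shows "card (forbidden E U v) \<le>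
    1 + (\<Sum>w\<in>{w. w \<in> {w \<in> V - U. 3 \<le> card (nbhd E w \<inter> U)} \<and> v \<in> nbhd E w}. 2 ^ (card (nbhd E w \<inter> U) - 1) - 1)
      + card {P \<in> pair_traces U. v \<in> P}"
proof -
  let ?P = "pair_traces U"
  let ?C = "{w. w \<in> {w \<in> V - U. 3 \<le> card (nbhd E w \<inter> U)} \<and> v \<in> nbhd E w}"
  let ?A = "\<Union>w\<in>?C. Pow (nbhd E w \<inter> U - {v}) - {{}}"
  let ?B = "(\<lambda>P. P - {v}) ` {P \<in> ?P. v \<in> P}"
  have fin: "finite U" using U fin_V finite_subset by blast
  have finP: "finite ?P" using fin by (intro finite_subset[of ?P "Pow U"]) auto
  have finC: "finite ?C" using fin_V by simp
  have finA: "finite ?A" using fin finC by auto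
  have finPv: "finite {P \<in> ?P. v \<in> P}" by (rule finite_subset[OF _ finP]) blast
  then have finB: "finite ?B" by (rule finite_imageI)
  have "forbidden E U v \<subseteq> insert {} (?A \<union> ?B)"
  proof
    fix S assume "S \<in> forbidden E U v"
    then obtain w where w: "w \<in> nbhd E v" "w \<notin> U" "S \<subseteq> nbhd E w \<inter> U - {v}"
      unfolding forbidden_def by blast
    have vw: "v \<in> nbhd E w" using w(1) in_nbhd_sym by metis
    have wV: "w \<in> V - U" using w edgeD unfolding nbhd_def by blast
    have finN: "finite (nbhd E w \<inter> U)" using fin by simp
    show "S \<in> insert {} (?A \<union> ?B)"
    proof (cases "S = {} \<or> 3 \<le> card (nbhd E w \<inter> U)")
      case True
      then show ?thesis using w wV vw by blast
    next
      case False
      then obtain s where s: "s \<in> S" by blast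
      have sub: "{v, s} \<subseteq> nbhd E w \<inter> U" "v \<noteq> s" using s w vw v by auto
      then have "card {v, s} \<le> card (nbhd E w \<inter> U)" by (intro card_mono finN)
      then have c2: "card (nbhd E w \<inter> U) = 2" using False sub(2) by simp
      then have N: "nbhd E w \<inter> U = {v, s}" using card_subset_eq[OF finN sub(1)] sub(2) by simp
      then have "S = nbhd E w \<inter> U - {v}" using s w(3) by blast
      moreover have "nbhd E w \<inter> U \<in> {P \<in> ?P. v \<in> P}" using c2 wV N by blast
      ultimately show ?thesis by blast
    qed
  qed
  then have "card (forbidden E U v) \<le> card (insert {} (?A \<union> ?B))"
    using finA finB by (intro card_mono finite.insertI finite_UnI)
  also have "\<dots> \<le> Suc (card (?A \<union> ?B))" by (rule card_insert_le_m1) simp_all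
  also have "card (?A \<union> ?B) \<le> card ?A + card ?B" by (rule card_Un_le)
  also have "card ?B \<le> card {P \<in> ?P. v \<in> P}" by (rule card_image_le[OF finPv])
  also have "card ?A \<le> (\<Sum>w\<in>?C. card (Pow (nbhd E w \<inter> U - {v}) - {{}}))"
    by (rule card_UN_le[OF finC])
  also have "\<dots> = (\<Sum>w\<in>?C. 2 ^ (card (nbhd E w \<inter> U) - 1) - 1)"
  proof (intro sum.cong refl)
    fix w assume "w \<in> ?C"
    then have "v \<in> nbhd E w \<inter> U" using v by simp
    then show "card (Pow (nbhd E w \<inter> U - {v}) - {{}}) = 2 ^ (card (nbhd E w \<inter> U) - 1) - 1"
      using fin by (simp add: card_Diff_subset card_Pow)
  qed
  finally show ?thesis by simp
qed

text \<open>The estimate \<open>k (2 ^ (k - 1) - 1) \<le> 14 (k - 2)\<close> for \<open>k \<in> {3, 4}\<close> is what makes the number of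
  forbidden sets comparable with the excess \<open>k - 2\<close> controlled by \<open>triangle_free_count\<close>. Summed
  over \<open>U\<close>, the number of forbidden sets plus \<open>7\<close> times the number of neighbours in \<open>U\<close> is less than
  \<open>35\<close> per vertex. A vertex below this average has at most four neighbours in \<open>U\<close>, and in the five
  cases fewer than \<open>35, 28, 21, 14, 7\<close> forbidden sets against \<open>128, 64, 32, 16, 8\<close> candidates.\<close>

lemma good_vertex:
  assumes g4: "\<And>xs. graph_cycle \<lparr>verts = V, edges = E\<rparr> xs \<Longrightarrow> 4 \<le> length xs"
    and U: "U \<subseteq> V" "U \<noteq> {}" and deg: "\<And>w. w \<in> V - U \<Longrightarrow> card (nbhd E w \<inter> U) \<le> 4"
  shows "\<exists>v\<in>U. card (nbhd E v \<inter> U) \<le> 4 \<and> card (forbidden E U v) * 2 ^ card (nbhd E v \<inter> U) < 2 ^ 7"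
proof -
  let ?P = "pair_traces U"
  define k where "k w = card (nbhd E w \<inter> U)" for w
  let ?C = "{w \<in> V - U. 3 \<le> k w}"
  have fin: "finite U" using U fin_V finite_subset by blast
  have finP: "finite ?P" using fin by (intro finite_subset[of ?P "Pow U"]) auto
  have finC: "finite ?C" using fin_V by simp
  have "(\<Sum>v\<in>U. card (forbidden E U v)) \<le>
      (\<Sum>v\<in>U. 1 + (\<Sum>w\<in>{w. w \<in> ?C \<and> v \<in> nbhd E w}. 2 ^ (k w - 1) - 1) + card {P \<in> ?P. v \<in> P})"
    unfolding k_def by (intro sum_mono card_forbidden_le[OF U(1)])
  also have "\<dots> = card U + (\<Sum>v\<in>U. \<Sum>w\<in>{w. w \<in> ?C \<and> v \<in> nbhd E w}. 2 ^ (k w - 1) - 1)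
      + (\<Sum>v\<in>U. card {P \<in> ?P. v \<in> P})"
    by (simp only: sum.distrib sum_constant) simp
  also have "(\<Sum>v\<in>U. card {P \<in> ?P. v \<in> P}) = 2 * card ?P"
  proof (rule sum_multicount[OF fin finP])
    show "\<forall>P\<in>?P. card {v \<in> U. v \<in> P} = 2"
    proof
      fix P assume P: "P \<in> ?P"
      then have "{v \<in> U. v \<in> P} = P" by auto
      then show "card {v \<in> U. v \<in> P} = 2" using P by simp
    qed
  qed
  also have "(\<Sum>v\<in>U. \<Sum>w\<in>{w. w \<in> ?C \<and> v \<in> nbhd E w}. 2 ^ (k w - 1) - 1) =
      (\<Sum>w\<in>?C. \<Sum>v\<in>{v. v \<in> U \<and> v \<in> nbhd E w}. 2 ^ (k w - 1) - 1)"
    by (rule sum.swap_restrict[OF fin finC])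
  also have "\<dots> \<le> (\<Sum>w\<in>?C. 14 * (k w - 2))"
  proof (rule sum_mono)
    fix w assume w: "w \<in> ?C"
    have "{v. v \<in> U \<and> v \<in> nbhd E w} = nbhd E w \<inter> U" by auto
    then have "(\<Sum>v\<in>{v. v \<in> U \<and> v \<in> nbhd E w}. 2 ^ (k w - 1) - 1) = k w * (2 ^ (k w - 1) - 1 :: nat)"
      by (simp add: k_def)
    moreover have "k w = 3 \<or> k w = 4" using w deg[of w] by (auto simp: k_def)
    ultimately show "(\<Sum>v\<in>{v. v \<in> U \<and> v \<in> nbhd E w}. 2 ^ (k w - 1) - 1) \<le> 14 * (k w - 2)" by auto
  qed
  also have "\<dots> = 14 * (\<Sum>w\<in>?C. k w - 2)" by (simp add: sum_distrib_left)
  finally have forb: "(\<Sum>v\<in>U. card (forbidden E U v)) \<le> card U + 14 * (\<Sum>w\<in>?C. k w - 2) + 2 * card ?P"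
    by simp
  have "(\<Sum>w\<in>?C. k w) = (\<Sum>w\<in>?C. (k w - 2) + 2)" by (intro sum.cong) auto
  then have kk: "(\<Sum>w\<in>?C. k w) = (\<Sum>w\<in>?C. k w - 2) + 2 * card ?C"
    by (simp only: sum.distrib sum_constant of_nat_id mult.commute)
  have "(\<Sum>v\<in>U. k v) + 2 * (\<Sum>w\<in>?C. k w) + 4 \<le> 4 * card U + 4 * card ?C"
    using triangle_free_count[OF g4 U, of ?C] unfolding k_def by blast
  then have "(\<Sum>v\<in>U. card (forbidden E U v)) + 7 * (\<Sum>v\<in>U. k v) < 35 * card U"
    using forb kk pair_count[OF U] by linarith
  then have lt: "(\<Sum>v\<in>U. card (forbidden E U v) + 7 * k v) < 35 * card U"
    by (simp add: sum.distrib sum_distrib_left)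
  have "\<exists>v\<in>U. card (forbidden E U v) + 7 * k v < 35"
  proof (rule ccontr)
    assume "\<not> (\<exists>v\<in>U. card (forbidden E U v) + 7 * k v < 35)"
    then have "(\<Sum>v\<in>U. 35) \<le> (\<Sum>v\<in>U. card (forbidden E U v) + 7 * k v)"
      by (intro sum_mono) (simp add: not_less)
    then show False using lt by simp
  qed
  then obtain v where v: "v \<in> U" "card (forbidden E U v) + 7 * k v < 35" by blast
  then have "k v = 0 \<or> k v = 1 \<or> k v = 2 \<or> k v = 3 \<or> k v = 4" by linarith
  then have "k v \<le> 4 \<and> card (forbidden E U v) * 2 ^ k v < 2 ^ 7" using v(2) by auto
  then show ?thesis using v(1) unfolding k_def by blast
qed

end

section \<open>From vectors to inversions\<close>

lemma inversion_mem:
  "(u, v) \<in> inversion X D \<longleftrightarrow> (if u \<in> X \<and> v \<in> X then (v, u) \<in> D else (u, v) \<in> D)"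
  unfolding inversion_def by auto

lemma fold_inversion_mem:
  "(u, v) \<in> fold inversion Xs D \<longleftrightarrow>
     (if even (length (filter (\<lambda>X. u \<in> X \<and> v \<in> X) Xs)) then (u, v) \<in> D else (v, u) \<in> D)"
proof (induction Xs arbitrary: D)
  case (Cons X Xs)
  then show ?case by (auto simp: inversion_mem)
qed simp

lemma fold_inversion_orientation:
  "D \<in> orientations G \<Longrightarrow> fold inversion Xs D \<in> orientations G"
  by (induction Xs arbitrary: D) (auto intro: inversion_orientations)

text \<open>An inequality only, because inversions that change nothing are not steps of the inversion graph
  and are skipped.\<close>

lemma dist_fold_inversion:
  assumes "D \<in> orientations G" "\<And>X. X \<in> set Xs \<Longrightarrow> X \<subseteq> verts G"
  shows "graph_dist (inversion_graph G) D (fold inversion Xs D) \<le> enat (length Xs)"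
proof -
  have "\<exists>ws. walk (inversion_graph G) ws \<and> hd ws = D \<and> last ws = fold inversion Xs D \<and>
      length ws \<le> Suc (length Xs)"
    using assms
  proof (induction Xs arbitrary: D)
    case Nil
    then show ?case by (intro exI[of _ "[D]"]) (simp add: walk_def inversion_graph_def)
  next
    case (Cons X Xs)
    obtain ws where ws: "walk (inversion_graph G) ws" "hd ws = inversion X D"
      "last ws = fold inversion Xs (inversion X D)" "length ws \<le> Suc (length Xs)"
      using Cons.IH[OF inversion_orientations[OF Cons.prems(1)], of X] Cons.prems(2)
      by (metis list.set_intros(2))
    show ?case
    proof (cases "inversion X D = D")
      case True
      then show ?thesis using ws by (intro exI[of _ ws]) simp
    next
      case False
      have "ws \<noteq> []" using ws(1) by (simp add: walk_def)
      have "X \<subseteq> verts G" using Cons.prems(2) by simp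
      then have "{D, inversion X D} \<in> edges (inversion_graph G)"
        using Cons.prems(1) False unfolding inversion_graph_def by (simp, metis)
      then have "walk (inversion_graph G) (D # ws)"
        using ws(1,2) Cons.prems(1) \<open>ws \<noteq> []\<close>
        by (auto simp: walk_def successively_Cons inversion_graph_def)
      then show ?thesis using ws \<open>ws \<noteq> []\<close> by (intro exI[of _ "D # ws"]) simp
    qed
  qed
  then obtain ws where ws: "walk (inversion_graph G) ws" "hd ws = D" "last ws = fold inversion Xs D"
      "length ws \<le> Suc (length Xs)" by blast
  have "graph_dist (inversion_graph G) D (fold inversion Xs D) \<le> enat (length ws - 1)"
    unfolding graph_dist_def using ws by (intro INF_lower) simp
  also have "\<dots> \<le> enat (length Xs)" using ws by simp
  finally show ?thesis .
qed

lemma sum_bit_eq_0_iff: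
  "finite A \<Longrightarrow> (\<Sum>i\<in>A. f i :: bit) = 0 \<longleftrightarrow> even (card {i \<in> A. f i = 1})"
proof (induction A rule: finite_induct)
  case (insert a A)
  have "{i \<in> insert a A. f i = 1} = (if f a = 1 then insert a {i \<in> A. f i = 1} else {i \<in> A. f i = 1})"
    by auto
  then show ?case using insert by (cases "f a") (auto simp: card_insert_if)
qed simp

text \<open>To get from \<open>D\<close> to \<open>D'\<close>, prescribe \<open>1\<close> on the edges where they differ and invert, for each
  coordinate \<open>i\<close>, the set of vertices whose vector has a \<open>1\<close> there: an edge is then reversed once for
  every coordinate contributing to the inner product of its ends.\<close>

lemma diam_le_of_vectors:
  assumes G: "simple_graph G"
    and vec: "\<And>\<pi> :: 'a set \<Rightarrow> bit. \<exists>x :: 'a \<Rightarrow> bit ^ 'n. \<forall>u v. {u, v} \<in> edges G \<longrightarrow> dot (x u) (x v) = \<pi> {u, v}"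
  shows "graph_diam (inversion_graph G) \<le> enat CARD('n)"
  unfolding graph_diam_def
proof (rule SUP_least, clarify)
  fix D D' assume "D \<in> verts (inversion_graph G)" "D' \<in> verts (inversion_graph G)"
  then have D: "D \<in> orientations G" and D': "D' \<in> orientations G" by (auto simp: inversion_graph_def)
  have arcs: "{u, v} \<in> edges G \<and> (v, u) \<notin> B" if "B \<in> orientations G" "(u, v) \<in> B" for B u v
  proof -
    have "{u, v} \<in> edges G" using that unfolding orientations_def by blast
    then show ?thesis using that unfolding orientations_def by blast
  qed
  have one: "(u, v) \<in> B \<longleftrightarrow> (v, u) \<notin> B" if "B \<in> orientations G" "{u, v} \<in> edges G" for B u v
    using that unfolding orientations_def by blast
  define \<pi> :: "'a set \<Rightarrow> bit" where "\<pi> e = (if \<exists>a b. e = {a, b} \<and> (a, b) \<in> D \<and> (a, b) \<notin> D' then 1 else 0)" for e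
  have \<pi>: "\<pi> {u, v} = 0 \<longleftrightarrow> ((u, v) \<in> D \<longleftrightarrow> (u, v) \<in> D')" if e: "{u, v} \<in> edges G" for u v
  proof -
    have "(\<exists>a b. {u, v} = {a, b} \<and> (a, b) \<in> D \<and> (a, b) \<notin> D') \<longleftrightarrow>
        (u, v) \<in> D \<and> (u, v) \<notin> D' \<or> (v, u) \<in> D \<and> (v, u) \<notin> D'"
      by (auto simp: doubleton_eq_iff)
    then show ?thesis using one[OF D e] one[OF D' e] unfolding \<pi>_def by auto
  qed
  obtain x :: "'a \<Rightarrow> bit ^ 'n" where x: "\<And>u v. {u, v} \<in> edges G \<Longrightarrow> dot (x u) (x v) = \<pi> {u, v}"
    using vec by blast
  obtain js :: "'n list" where js: "set js = UNIV" "distinct js"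
    using finite_distinct_list[of "UNIV :: 'n set"] by auto
  define X where "X i = {v \<in> verts G. x v $ i = 1}" for i
  let ?Xs = "map X js"
  have par: "even (length (filter (\<lambda>X. u \<in> X \<and> v \<in> X) ?Xs)) \<longleftrightarrow> \<pi> {u, v} = 0"
    if e: "{u, v} \<in> edges G" for u v
  proof -
    have uv: "u \<in> verts G" "v \<in> verts G" using G e unfolding simple_graph_def by blast+
    have "length (filter (\<lambda>X. u \<in> X \<and> v \<in> X) ?Xs) = length (filter (\<lambda>i. u \<in> X i \<and> v \<in> X i) js)"
      by (simp add: filter_map o_def)
    also have "\<dots> = card {i \<in> UNIV. u \<in> X i \<and> v \<in> X i}"
      using js distinct_card[of "filter (\<lambda>i. u \<in> X i \<and> v \<in> X i) js"] by simp
    also have "{i \<in> UNIV. u \<in> X i \<and> v \<in> X i} = {i \<in> UNIV. x u $ i * x v $ i = 1}"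
      using uv unfolding X_def by auto
    finally show ?thesis
      using x[OF e] sum_bit_eq_0_iff[of "UNIV :: 'n set" "\<lambda>i. x u $ i * x v $ i"] unfolding dot_def by simp
  qed
  have "fold inversion ?Xs D = D'"
  proof (rule set_eqI, clarify)
    fix u v
    show "(u, v) \<in> fold inversion ?Xs D \<longleftrightarrow> (u, v) \<in> D'"
    proof (cases "{u, v} \<in> edges G")
      case True
      then show ?thesis using par[OF True] \<pi>[OF True] one[OF D True] unfolding fold_inversion_mem by auto
    next
      case False
      then show ?thesis using arcs[OF D'] arcs[OF fold_inversion_orientation[OF D]] by blast
    qed
  qed
  moreover have "graph_dist (inversion_graph G) D (fold inversion ?Xs D) \<le> enat (length ?Xs)"
    by (rule dist_fold_inversion[OF D]) (auto simp: X_def)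
  moreover have "length ?Xs = CARD('n)" using js by (metis distinct_card length_map)
  ultimately show "graph_dist (inversion_graph G) D D' \<le> enat CARD('n)" by simp
qed

theorem theorem1p3:
  fixes G :: "'a ugraph"
  assumes "simple_graph G" and "planar G" and "girth G \<ge> 4"
  shows "graph_diam (inversion_graph G) \<le> 7"
proof -
  have G: "\<lparr>verts = verts G, edges = edges G\<rparr> = G" by (cases G) simp
  obtain p \<gamma> where "plane_drawing G p \<gamma>" using assms(2) unfolding planar_def by blast
  then interpret plane_graph "verts G" "edges G" p \<gamma>
    using assms(1) by unfold_locales (simp_all add: G)
  have g4: "4 \<le> length xs" if "graph_cycle G xs" for xs
  proof -
    have "girth G \<le> enat (length xs)" unfolding girth_def using that by (intro INF_lower) simp
    then have "4 \<le> enat (length xs)" using assms(3) by (rule order_trans[rotated])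
    then show ?thesis by (simp add: numeral_eq_enat)
  qed
  have "\<exists>x :: 'a \<Rightarrow> bit ^ 7. \<forall>u v. {u, v} \<in> edges G \<longrightarrow> dot (x u) (x v) = \<pi> {u, v}"
    for \<pi> :: "'a set \<Rightarrow> bit"
  proof (rule greedy_vectors[OF fin_V edgeD])
    fix U assume "U \<subseteq> verts G" "U \<noteq> {}" "\<And>w. w \<in> verts G - U \<Longrightarrow> card (nbhd (edges G) w \<inter> U) \<le> 4"
    then show "\<exists>v\<in>U. card (nbhd (edges G) v \<inter> U) \<le> 4 \<and>
        card (forbidden (edges G) U v) * 2 ^ card (nbhd (edges G) v \<inter> U) < 2 ^ CARD(7)"
      using good_vertex[of U] g4 unfolding G by simp
  qed
  then have "graph_diam (inversion_graph G) \<le> enat CARD(7)" by (rule diam_le_of_vectors[OF assms(1)])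
  then show ?thesis by (simp add: numeral_eq_enat)
qed

end
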